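(* Let $b>0$ and let $X_\varepsilon$, $Y_\varepsilon$, $G_\varepsilon$, $f_b$ be as defined in the context. On the covering space $\mathbb{R}^3_{(p,q,\tau)}$, $$-\frac{\cot\varepsilon}{b}\,G_\varepsilon\longrightarrow f_b\qquad\text{in }C^\infty_{\mathrm{loc}}\quad\text{as }\varepsilon\to0\ (\varepsilon\ne0).$$ Equivalently, after choosing either sheet over a relatively compact simply connected open set $U\Subset\mathbb{R}^3\setminus\Gamma_b$, where $\Gamma_b=\{x_3=0,\ 2bx_1=x_2^2\}$, the corresponding rescaled single-valued graph potentials $-(\cot\varepsilon/b)G_\varepsilon$ (viewed as functions of $\mathbf{x}\in U$ through the local inverse of $X_\varepsilon$ on the sheet near the chosen $X_0$-sheet) converge locally smoothly to that branch of $f_b$.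
   Context: For $|\varepsilon|<\pi/2$ define $\Psi_\varepsilon=X_\varepsilon+\sqrt{-1}\,Y_\varepsilon:\mathbb{R}^3_{(p,q,\tau)}\to\mathbb{C}^3$ by $$X_\varepsilon=\Big(\tfrac{p^2+q^2}{2}-\tfrac{b}{2\cos^2\varepsilon}\sinh^2\tau,\ \sqrt b\,\cosh\tau\,p,\ \sqrt b\,\sinh\tau\,q\Big),$$ $$Y_\varepsilon=\big(-b\tan\varepsilon\,\tau,\ \sqrt b\,\tan\varepsilon\,\sinh\tau\,p,\ -\sqrt b\,\tan\varepsilon\,\cosh\tau\,q\big).$$ For small $\varepsilon\ne0$ the image $L_\varepsilon=\Psi_\varepsilon(\mathbb{R}^3)$ is an embedded special Lagrangian 3-fold (Joyce). With coordinates $z_j=x_j+\sqrt{-1}y_j$ on $\mathbb{C}^3\cong T^*\mathbb{R}^3$ and the Liouville form $\lambda_{\mathrm{can}}=-\sum_{j=1}^3y_j\,dx_j$, the graph potential $G_\varepsilon:\mathbb{R}^3_{(p,q,\tau)}\to\mathbb{R}$ is the function with $\Psi_\varepsilon^*\lambda_{\mathrm{can}}=-dG_\varepsilon$, i.e. $dG_\varepsilon=\sum_jY_{\varepsilon,j}\,dX_{\varepsilon,j}$, normalized to vanish over $\Gamma_b$, i.e. on $\{q=\tau=0\}$. The involution $(p,q,\tau)\mapsto(p,-q,-\tau)$ preserves $X_\varepsilon$, and $X_\varepsilon$ is a two-to-one map onto $\mathbb{R}^3$ branched along $\Gamma_b$; a sheet over $U$ is one of the two open sets mapped diffeomorphically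 onto $U$. The function $f_b$ on the covering space: put $\mathbf{x}=X_0(p,q,\tau)$, $\mu_3=\sqrt b\,\sinh\tau$, and $$f_b=f_2(\mu_3)+\Big(x_1+\frac b4\Big)f_1(\mu_3)+\frac12P_b(\mathbf{x})f_3(\mu_3),$$ where $f_1(\mu_3)=\int_0^{\mu_3}\frac{dv}{\sqrt{b+v^2}}$, $f_2(\mu_3)=\int_0^{\mu_3}\frac{v^2dv}{\sqrt{b+v^2}}$, $f_3(\mu_3)=\int_0^{\mu_3}\frac{dv}{(v^2+b/2)^2\sqrt{b+v^2}}$, and $P_b(\mathbf{x})=-\frac b8(b^2-4bx_1+4x_2^2-4x_3^2)$. It is odd under $(p,q,\tau)\mapsto(p,-q,-\tau)$ and descends to a two-valued function on $\mathbb{R}^3$ branched along $\Gamma_b$. *)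

theory Defs
  imports "HOL-Analysis.Analysis"
begin

section \<open>Smooth functions and local smooth convergence\<close>

text \<open>
  The iterated partial derivative along the list of coordinate directions, the last one
  being taken first.  On an open set, membership in \<open>smooth_on\<close> is membership in
  $C^\infty$: each iterated partial derivative is totally differentiable, hence continuous.
  The order of the directions is not normalised, since for smooth functions it does not matter.
\<close>

primrec iter_partial ::
    "'n list \<Rightarrow> (real^'n \<Rightarrow> 'b::real_normed_vector) \<Rightarrow> real^'n::finite \<Rightarrow> 'b" where
  "iter_partial [] f = f"
| "iter_partial (i # js) f =
     (\<lambda>x. frechet_derivative (iter_partial js f) (at x) (axis i 1))"

definition smooth_on :: "(real^'n) set \<Rightarrow> (real^'n::finite \<Rightarrow> 'b::real_normed_vector) \<Rightarrow> bool" where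
  "smooth_on S f \<longleftrightarrow> (\<forall>js. \<forall>x\<in>S. iter_partial js f differentiable (at x))"

text \<open>
  Convergence in $C^\infty_{\mathrm{loc}}(S)$ for open \<open>S\<close>: the limit and eventually all members
  are smooth on \<open>S\<close>, and all partial derivatives of all orders converge uniformly on compact
  subsets of \<open>S\<close>.
\<close>

definition smooth_loc_limit ::
    "(real^'n) set \<Rightarrow> ('i \<Rightarrow> real^'n::finite \<Rightarrow> 'b::real_normed_vector) \<Rightarrow> (real^'n \<Rightarrow> 'b)
      \<Rightarrow> 'i filter \<Rightarrow> bool" where
  "smooth_loc_limit S f g F \<longleftrightarrow>
     smooth_on S g \<and> (\<forall>\<^sub>F i in F. smooth_on S (f i)) \<and>
     (\<forall>K js. compact K \<and> K \<subseteq> S \<longrightarrow>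
        uniform_limit K (\<lambda>i. iter_partial js (f i)) (iter_partial js g) F)"

definition diffeo_onto ::
    "(real^'n::finite \<Rightarrow> real^'n) \<Rightarrow> (real^'n) set \<Rightarrow> (real^'n) set \<Rightarrow> bool" where
  "diffeo_onto f S U \<longleftrightarrow> open S \<and> open U \<and> bij_betw f S U \<and>
     smooth_on S f \<and> smooth_on U (the_inv_into S f)"

section \<open>The special Lagrangian family\<close>

text \<open>A point \<open>v\<close> of the covering space has the coordinates $(p, q, \tau)$ = \<open>(v $ 1, v $ 2, v $ 3)\<close>.
  \<open>X_map b \<epsilon>\<close> and \<open>Y_map b \<epsilon>\<close> are the real and imaginary part of $\Psi_\varepsilon$.\<close>

definition X_map :: "real \<Rightarrow> real \<Rightarrow> real^3 \<Rightarrow> real^3" where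
  "X_map b \<epsilon> v = (let p = v $ 1; q = v $ 2; \<tau> = v $ 3 in
     vector [(p\<^sup>2 + q\<^sup>2) / 2 - b / (2 * (cos \<epsilon>)\<^sup>2) * (sinh \<tau>)\<^sup>2,
             sqrt b * cosh \<tau> * p,
             sqrt b * sinh \<tau> * q])"

definition Y_map :: "real \<Rightarrow> real \<Rightarrow> real^3 \<Rightarrow> real^3" where
  "Y_map b \<epsilon> v = (let p = v $ 1; q = v $ 2; \<tau> = v $ 3 in
     vector [- b * tan \<epsilon> * \<tau>,
             sqrt b * tan \<epsilon> * sinh \<tau> * p,
             - sqrt b * tan \<epsilon> * cosh \<tau> * q])"

text \<open>$dG = \sum_j Y_j\,dX_j$ together with the normalisation on $\{q = \tau = 0\}$.\<close>

definition is_graph_potential :: "real \<Rightarrow> real \<Rightarrow> (real^3 \<Rightarrow> real) \<Rightarrow> bool" where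
  "is_graph_potential b \<epsilon> G \<longleftrightarrow>
     (\<forall>v. (G has_derivative
        (\<lambda>h. \<Sum>j\<in>UNIV. Y_map b \<epsilon> v $ j * frechet_derivative (\<lambda>w. X_map b \<epsilon> w $ j) (at v) h)) (at v)) \<and>
     (\<forall>v. v $ 2 = 0 \<and> v $ 3 = 0 \<longrightarrow> G v = 0)"

definition graph_potential :: "real \<Rightarrow> real \<Rightarrow> real^3 \<Rightarrow> real" where
  "graph_potential b \<epsilon> = (THE G. is_graph_potential b \<epsilon> G)"

definition Gamma_curve :: "real \<Rightarrow> (real^3) set" where
  "Gamma_curve b = {x. x $ 3 = 0 \<and> 2 * b * x $ 1 = (x $ 2)\<^sup>2}"

section \<open>The limit function\<close>

text \<open>The interval integrals are oriented, so they are odd in \<open>\<mu>\<close>.\<close>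

definition f1 :: "real \<Rightarrow> real \<Rightarrow> real" where
  "f1 b \<mu> = (LBINT v=ereal 0..ereal \<mu>. 1 / sqrt (b + v\<^sup>2))"

definition f2 :: "real \<Rightarrow> real \<Rightarrow> real" where
  "f2 b \<mu> = (LBINT v=ereal 0..ereal \<mu>. v\<^sup>2 / sqrt (b + v\<^sup>2))"

definition f3 :: "real \<Rightarrow> real \<Rightarrow> real" where
  "f3 b \<mu> = (LBINT v=ereal 0..ereal \<mu>. 1 / ((v\<^sup>2 + b / 2)\<^sup>2 * sqrt (b + v\<^sup>2)))"

definition P_poly :: "real \<Rightarrow> real^3 \<Rightarrow> real" where
  "P_poly b x = - (b / 8) * (b\<^sup>2 - 4 * b * x $ 1 + 4 * (x $ 2)\<^sup>2 - 4 * (x $ 3)\<^sup>2)"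

definition f_cover :: "real \<Rightarrow> real^3 \<Rightarrow> real" where
  "f_cover b v = (let x = X_map b 0 v; \<mu> = sqrt b * sinh (v $ 3) in
     f2 b \<mu> + (x $ 1 + b / 4) * f1 b \<mu> + 1 / 2 * P_poly b x * f3 b \<mu>)"

section \<open>Sheets\<close>

definition is_sheet :: "real \<Rightarrow> real \<Rightarrow> (real^3) set \<Rightarrow> (real^3) set \<Rightarrow> bool" where
  "is_sheet b \<epsilon> U S \<longleftrightarrow> diffeo_onto (X_map b \<epsilon>) S U"

definition sheet_inv :: "real \<Rightarrow> real \<Rightarrow> (real^3) set \<Rightarrow> real^3 \<Rightarrow> real^3" where
  "sheet_inv b \<epsilon> S = the_inv_into S (X_map b \<epsilon>)"

text \<open>
  \<open>T \<epsilon>\<close> is, for small \<open>\<epsilon> \<noteq> 0\<close>, the sheet of $X_\varepsilon$ over \<open>U\<close> near the sheet \<open>S\<close> of $X_0$: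
  the local inverses converge uniformly to the one given by \<open>S\<close>.  The other sheet is the image
  under $(p,q,\tau) \mapsto (p,-q,-\tau)$, which stays a positive distance away when \<open>U\<close> is
  relatively compact in the complement of the branch curve; so this determines \<open>T \<epsilon>\<close> for small \<open>\<epsilon>\<close>.
\<close>

definition nearby_sheets ::
    "real \<Rightarrow> (real^3) set \<Rightarrow> (real^3) set \<Rightarrow> (real \<Rightarrow> (real^3) set) \<Rightarrow> bool" where
  "nearby_sheets b U S T \<longleftrightarrow>
     (\<forall>\<^sub>F \<epsilon> in at 0. is_sheet b \<epsilon> U (T \<epsilon>)) \<and>
     uniform_limit U (\<lambda>\<epsilon>. sheet_inv b \<epsilon> (T \<epsilon>)) (sheet_inv b 0 S) (at 0)"

end

theory Submission
  imports Defs
begin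

text \<open>
  The angle enters only through $a = 1/\cos^2\varepsilon$.  Integrating $\sum_j Y_j\,dX_j$ by hand shows
  that $-(\cot\varepsilon/b)\,G_\varepsilon$ equals
  $$\frac{p^2}{2}(\tau - \sinh\tau\cosh\tau) + \frac{q^2}{2}(\tau + \sinh\tau\cosh\tau)
    - b\,a\,\Bigl(\frac{\tau\sinh^2\tau}{2} - \frac{\sinh\tau\cosh\tau - \tau}{4}\Bigr)$$
  (\<open>rescaled_graph_potential\<close>), and evaluating the three integrals shows that the same expression with
  $a = 1$ is $f_b$ (\<open>f_cover_eq\<close>).  As it is affine in \<open>a\<close> with smooth coefficients, convergence on the covering
  space is clear.

  On a sheet, let $s_\varepsilon$ be the local inverse of $X_\varepsilon$ and $M_a$ the inverse of its Jacobian matrix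
  as a function on the covering space.  Away from the axis $q = \tau = 0$, which lies over the branch curve,
  $M_a$ has smooth entries given explicitly in terms of \<open>p\<close>, \<open>q\<close>, \<open>\<tau>\<close>, $\sinh\tau$ and $\cosh\tau$.  From
  $Ds_\varepsilon = M_a(s_\varepsilon)$ it follows by induction that every partial derivative of a composition
  $g_a \circ s_\varepsilon$ is $h_a \circ s_\varepsilon$ for one family $h$, the same for all
  $\varepsilon$ and jointly continuous in \<open>a\<close> and the point (\<open>elementary_pullback\<close>).  So uniform convergence of
  $s_\varepsilon$, which is the definition of a nearby sheet, implies convergence of all derivatives
  (\<open>smooth_loc_limit_pullback\<close>).

  It remains to see that nearby sheets exist.  There is a map $\Phi_a$ of the covering space with
  $X_\varepsilon \circ \Phi_a = X_0$: the map scales $\sinh\tau$ by $\sqrt\sigma$ and \<open>q\<close> by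
  $1/\sqrt\sigma$, where $\sigma$ is the root of a monotone equation, and this root lies between $1/a$ and $1$.
  The bracket shows that $\Phi_a$ is close to the identity on bounded sets (\<open>transport_dist\<close>), and
  since $X_0$ is proper, the image of a sheet of $X_0$ under $\Phi_a$ is a nearby sheet (\<open>nearby_sheets_exist\<close>).
\<close>

section \<open>Families of functions closed under differentiation\<close>

text \<open>
  A family of functions on \<open>W\<close>, indexed by a real parameter \<open>a\<close>.  The class is generated by just the
  functions that occur in the charts and the potential, with reciprocals admitted wherever they are
  defined for every \<open>a > 0\<close> on \<open>W\<close>.  Its two properties used below are that it is closed under partial
  derivatives and that its members are jointly continuous in \<open>a\<close> and the point; so every
  iterated derivative converges locally uniformly when \<open>a\<close> does.
\<close>

inductive elementary :: "(real^3) set \<Rightarrow> (real \<Rightarrow> real^3 \<Rightarrow> real) \<Rightarrow> bool"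
  for W where
  const: "elementary W (\<lambda>a v. c)"
| param: "elementary W (\<lambda>a v. a)"
| coord: "elementary W (\<lambda>a v. v $ i)"
| sinh: "elementary W (\<lambda>a v. sinh (v $ 3))"
| cosh: "elementary W (\<lambda>a v. cosh (v $ 3))"
| add: "elementary W g \<Longrightarrow> elementary W h \<Longrightarrow> elementary W (\<lambda>a v. g a v + h a v)"
| mult: "elementary W g \<Longrightarrow> elementary W h \<Longrightarrow> elementary W (\<lambda>a v. g a v * h a v)"
| inverse: "elementary W g \<Longrightarrow> (\<And>a v. a > 0 \<Longrightarrow> v \<in> W \<Longrightarrow> g a v \<noteq> 0)
    \<Longrightarrow> elementary W (\<lambda>a v. inverse (g a v))"

lemma elementary_minus: "elementary W g \<Longrightarrow> elementary W (\<lambda>a v. - g a v)"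
  using elementary.mult[OF elementary.const[of W "-1"]] by simp

lemma elementary_diff:
  "elementary W g \<Longrightarrow> elementary W h \<Longrightarrow> elementary W (\<lambda>a v. g a v - h a v)"
  using elementary.add[OF _ elementary_minus] by simp

lemma elementary_divide:
  "elementary W g \<Longrightarrow> elementary W h \<Longrightarrow> (\<And>a v. a > 0 \<Longrightarrow> v \<in> W \<Longrightarrow> h a v \<noteq> 0)
    \<Longrightarrow> elementary W (\<lambda>a v. g a v / h a v)"
  unfolding divide_inverse by (intro elementary.mult elementary.inverse)

lemma elementary_power: "elementary W g \<Longrightarrow> elementary W (\<lambda>a v. g a v ^ n)"
  by (induction n) (auto intro: elementary.const elementary.mult)

lemmas elementary_intros = elementary.const elementary.param elementary.coord elementary.sinh
  elementary.cosh elementary.add elementary.mult elementary_minus elementary_diff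
  elementary_divide elementary_power

lemma elementary_continuous:
  assumes "elementary W g"
  shows "continuous_on ({0<..} \<times> W) (\<lambda>(a, v). g a v)"
  using assms
  by induction (auto intro!: continuous_intros simp: case_prod_unfold)

lemma has_derivative_nth:
  "((\<lambda>v::real^3. v $ i) has_derivative (\<lambda>d. d $ i)) (at v)"
  by (rule bounded_linear_imp_has_derivative[OF bounded_linear_vec_nth])

lemma has_derivative_sinh_nth:
  "((\<lambda>v::real^3. sinh (v $ i)) has_derivative (\<lambda>d. cosh (v $ i) * d $ i)) (at v)"
proof -
  have "DERIV sinh (v $ i) :> cosh (v $ i)"
    by (auto intro!: derivative_eq_intros)
  from DERIV_compose_FDERIV[OF this has_derivative_nth] show ?thesis
    by (simp add: mult.commute)
qed

lemma has_derivative_cosh_nth: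
  "((\<lambda>v::real^3. cosh (v $ i)) has_derivative (\<lambda>d. sinh (v $ i) * d $ i)) (at v)"
proof -
  have "DERIV cosh (v $ i) :> sinh (v $ i)"
    by (auto intro!: derivative_eq_intros)
  from DERIV_compose_FDERIV[OF this has_derivative_nth] show ?thesis
    by (simp add: mult.commute)
qed

lemmas nth_derivatives = has_derivative_nth has_derivative_sinh_nth has_derivative_cosh_nth

text \<open>
  Closure under partial derivatives.  One gradient serves all parameters at once, and its components
  are again families of the class, so the statement can be iterated.
\<close>

lemma elementary_gradient:
  assumes "elementary W g"
  shows "\<exists>g'. (\<forall>i. elementary W (\<lambda>a v. g' a v $ i)) \<and>
    (\<forall>a>0. \<forall>v\<in>W. (g a has_derivative (\<lambda>d. g' a v \<bullet> d)) (at v))"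
  using assms
proof induction
  case (const c)
  show ?case
    by (rule exI[of _ "\<lambda>a v. 0"]) (auto intro: elementary_intros)
next
  case param
  show ?case
    by (rule exI[of _ "\<lambda>a v. 0"]) (auto intro: elementary_intros)
next
  case (coord i)
  have "((\<lambda>v::real^3. v $ i) has_derivative (\<lambda>d. axis i 1 \<bullet> d)) (at v)" for v
    using has_derivative_nth[of i v] by (simp add: inner_axis')
  then show ?case
    by (intro exI[of _ "\<lambda>a v. axis i 1"]) (auto intro: elementary_intros)
next
  case sinh
  have "((\<lambda>v::real^3. sinh (v $ 3)) has_derivative (\<lambda>d. axis 3 (cosh (v $ 3)) \<bullet> d)) (at v)" for v
    using has_derivative_sinh_nth[of 3 v] by (simp add: inner_axis' mult.commute)
  moreover have "elementary W (\<lambda>a v. axis 3 (cosh (v $ 3)) $ i)" for i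
    by (cases "i = 3") (auto simp: axis_def intro: elementary_intros)
  ultimately show ?case
    by (intro exI[of _ "\<lambda>a v. axis 3 (cosh (v $ 3))"]) auto
next
  case cosh
  have "((\<lambda>v::real^3. cosh (v $ 3)) has_derivative (\<lambda>d. axis 3 (sinh (v $ 3)) \<bullet> d)) (at v)" for v
    using has_derivative_cosh_nth[of 3 v] by (simp add: inner_axis' mult.commute)
  moreover have "elementary W (\<lambda>a v. axis 3 (sinh (v $ 3)) $ i)" for i
    by (cases "i = 3") (auto simp: axis_def intro: elementary_intros)
  ultimately show ?case
    by (intro exI[of _ "\<lambda>a v. axis 3 (sinh (v $ 3))"]) auto
next
  case (add g h)
  then obtain g' h' where *: "\<forall>i. elementary W (\<lambda>a v. g' a v $ i)" "\<forall>i. elementary W (\<lambda>a v. h' a v $ i)"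
    "\<forall>a>0. \<forall>v\<in>W. (g a has_derivative (\<lambda>d. g' a v \<bullet> d)) (at v)"
    "\<forall>a>0. \<forall>v\<in>W. (h a has_derivative (\<lambda>d. h' a v \<bullet> d)) (at v)"
    by blast
  show ?case
    using * by (intro exI[of _ "\<lambda>a v. g' a v + h' a v"])
      (auto simp: inner_add_left intro!: elementary_intros has_derivative_add)
next
  case (mult g h)
  then obtain g' h' where *: "\<forall>i. elementary W (\<lambda>a v. g' a v $ i)" "\<forall>i. elementary W (\<lambda>a v. h' a v $ i)"
    "\<forall>a>0. \<forall>v\<in>W. (g a has_derivative (\<lambda>d. g' a v \<bullet> d)) (at v)"
    "\<forall>a>0. \<forall>v\<in>W. (h a has_derivative (\<lambda>d. h' a v \<bullet> d)) (at v)"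
    by blast
  have "((\<lambda>v. g a v * h a v) has_derivative (\<lambda>d. (g a v *\<^sub>R h' a v + h a v *\<^sub>R g' a v) \<bullet> d)) (at v)"
    if "a > 0" "v \<in> W" for a v
    using has_derivative_mult[OF *(3)[rule_format, OF that] *(4)[rule_format, OF that]]
    by (simp add: inner_add_left algebra_simps)
  then show ?case
    using * mult.hyps by (intro exI[of _ "\<lambda>a v. g a v *\<^sub>R h' a v + h a v *\<^sub>R g' a v"])
      (auto intro!: elementary_intros)
next
  case (inverse g)
  then obtain g' where *: "\<forall>i. elementary W (\<lambda>a v. g' a v $ i)"
    "\<forall>a>0. \<forall>v\<in>W. (g a has_derivative (\<lambda>d. g' a v \<bullet> d)) (at v)"
    by blast
  have inv: "elementary W (\<lambda>a v. inverse (g a v))"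
    using inverse.hyps by (rule elementary.inverse)
  have "((\<lambda>v. inverse (g a v)) has_derivative
      (\<lambda>d. (- (inverse (g a v) * inverse (g a v)) *\<^sub>R g' a v) \<bullet> d)) (at v)"
    if "a > 0" "v \<in> W" for a v
    using Deriv.has_derivative_inverse[OF inverse.hyps(2)[OF that] *(2)[rule_format, OF that]]
    by (simp add: algebra_simps)
  then show ?case
    using * by (intro exI[of _ "\<lambda>a v. - (inverse (g a v) * inverse (g a v)) *\<^sub>R g' a v"])
      (auto intro!: elementary_intros inv simp del: inverse_mult_distrib)
qed

lemma derivative_cong_open:
  assumes "open U" "x \<in> U" "\<And>y. y \<in> U \<Longrightarrow> f y = g y" "(g has_derivative g') (at x)"
  shows "(f has_derivative g') (at x)" "frechet_derivative f (at x) = g'"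
proof -
  show "(f has_derivative g') (at x)"
    using assms by (intro has_derivative_transform_within_open[OF assms(4,1,2)]) auto
  then show "frechet_derivative f (at x) = g'"
    by (metis frechet_derivative_at)
qed

text \<open>
  The map \<open>s\<close> solves the total differential equation $Ds = M_a(s)$ on \<open>U\<close>.  The local inverses of a
  family of maps satisfy such an equation, with \<open>M\<close> the inverse Jacobian; the identity satisfies it with
  \<open>M\<close> the unit matrix.
\<close>

definition solves ::
    "(real^3) set \<Rightarrow> (real \<Rightarrow> real^3 \<Rightarrow> real^3^3) \<Rightarrow> real \<Rightarrow> (real^3) set \<Rightarrow> (real^3 \<Rightarrow> real^3) \<Rightarrow> bool"
  where "solves W M a U s \<longleftrightarrow> a > 0 \<and> open U \<and> s ` U \<subseteq> W \<and>
    (\<forall>x\<in>U. (s has_derivative (\<lambda>d. M a (s x) *v d)) (at x))"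

text \<open>
  Since $Ds = M_a(s)$, a partial derivative of $g_a \<circ> s$ is again of the form $h_a \<circ> s$, where
  \<open>h\<close> is the gradient of \<open>g\<close> contracted with a column of \<open>M\<close>.  Hence higher derivatives of \<open>s\<close>
  never appear.  What matters is that \<open>h\<close> depends neither on the parameter value nor on the solution
  \<open>s\<close>: convergence of the parameters and of the solutions alone will give convergence of all derivatives.
\<close>

lemma elementary_pullback:
  assumes g: "elementary W g" and M: "\<And>i k. elementary W (\<lambda>a v. M a v $ i $ k)"
  shows "\<exists>h. elementary W h \<and> (\<forall>a U s. solves W M a U s \<longrightarrow>
    (\<forall>x\<in>U. iter_partial js (\<lambda>x. g a (s x)) differentiable (at x) \<and>
      iter_partial js (\<lambda>x. g a (s x)) x = h a (s x)))"
proof -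
  have chain: "((\<lambda>x. h a (s x)) has_derivative (\<lambda>d. h' a (s x) \<bullet> (M a (s x) *v d))) (at x)"
    if h': "\<forall>a>0. \<forall>v\<in>W. (h a has_derivative (\<lambda>d. h' a v \<bullet> d)) (at v)"
      and s: "solves W M a U s" "x \<in> U" for h h' a s U x
  proof -
    have 1: "(s has_derivative (\<lambda>d. M a (s x) *v d)) (at x)"
      using s by (simp add: solves_def)
    have 2: "(h a has_derivative (\<lambda>d. h' a (s x) \<bullet> d)) (at (s x))"
      using s by (intro h'[rule_format]) (auto simp: solves_def)
    show ?thesis
      using has_derivative_compose[OF 1 2] .
  qed
  show ?thesis
  proof (induction js)
    case Nil
    obtain g' where "\<forall>a>0. \<forall>v\<in>W. (g a has_derivative (\<lambda>d. g' a v \<bullet> d)) (at v)"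
      using elementary_gradient[OF g] by blast
    from differentiableI[OF chain[OF this]] show ?case
      by (intro exI[of _ g]) (simp add: g)
  next
    case (Cons i js)
    then obtain h where h: "elementary W h"
      and "\<forall>a U s. solves W M a U s \<longrightarrow>
        (\<forall>x\<in>U. iter_partial js (\<lambda>x. g a (s x)) differentiable (at x) \<and>
          iter_partial js (\<lambda>x. g a (s x)) x = h a (s x))"
      by (elim exE conjE)
    then have h_eq: "iter_partial js (\<lambda>x. g a (s x)) x = h a (s x)"
      if "solves W M a U s" "x \<in> U" for a U s x
      using that by simp
    obtain h' where h'_el: "\<And>i. elementary W (\<lambda>a v. h' a v $ i)"
      and h': "\<forall>a>0. \<forall>v\<in>W. (h a has_derivative (\<lambda>d. h' a v \<bullet> d)) (at v)"
      using elementary_gradient[OF h] by blast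
    \<comment> \<open>By the chain rule this is the derivative of \<open>h a \<circ> s\<close> in direction \<open>i\<close>, as a function of the value of \<open>s\<close>.\<close>
    define k where "k = (\<lambda>a v. h' a v \<bullet> (M a v *v axis i 1))"
    have k_eq: "k = (\<lambda>a v. h' a v $ 1 * M a v $ 1 $ i + h' a v $ 2 * M a v $ 2 $ i
        + h' a v $ 3 * M a v $ 3 $ i)"
      by (simp add: k_def fun_eq_iff inner_vec_def sum_3 matrix_vector_mult_basis column_def)
    have k: "elementary W k"
      unfolding k_eq by (intro elementary_intros h'_el M)
    obtain k' where k': "\<forall>a>0. \<forall>v\<in>W. (k a has_derivative (\<lambda>d. k' a v \<bullet> d)) (at v)"
      using elementary_gradient[OF k] by blast
    show ?case
    proof (intro exI[of _ k] conjI k allI impI ballI)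
      fix a U s x
      assume s: "solves W M a U s" and x: "x \<in> U"
      then have U: "open U" by (simp add: solves_def)
      have eq: "iter_partial (i # js) (\<lambda>x. g a (s x)) x = k a (s x)" if "x \<in> U" for x
        using derivative_cong_open(2)[OF U that h_eq[OF s] chain[OF h' s that]]
        by (simp add: k_def)
      show "iter_partial (i # js) (\<lambda>x. g a (s x)) differentiable (at x)"
        by (rule differentiableI, rule derivative_cong_open(1)[OF U x eq
          chain[OF k' s x]])
      show "iter_partial (i # js) (\<lambda>x. g a (s x)) x = k a (s x)"
        by (rule eq[OF x])
    qed
  qed
qed

text \<open>
  Smoothness of the charts is checked in components, as the class above consists of scalar functions.
\<close>

lemma smooth_on_vec:
  fixes f :: "real^'n::finite \<Rightarrow> real^'m::finite"
  assumes S: "open S" and f: "\<And>k. smooth_on S (\<lambda>x. f x $ k)"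
  shows "smooth_on S f"
proof -
  have "\<forall>x\<in>S. iter_partial js f differentiable (at x) \<and>
      (\<forall>k. iter_partial js f x $ k = iter_partial js (\<lambda>x. f x $ k) x)" for js
  proof (induction js)
    have comp: "\<forall>x\<in>S. iter_partial js f differentiable (at x)"
      if "\<forall>x\<in>S. \<forall>k. iter_partial js f x $ k = iter_partial js (\<lambda>x. f x $ k) x" for js
    proof
      fix x assume x: "x \<in> S"
      have "(\<lambda>x. iter_partial js f x $ k) differentiable (at x)" for k
      proof -
        obtain D where D: "(iter_partial js (\<lambda>x. f x $ k) has_derivative D) (at x)"
          using f x unfolding smooth_on_def differentiable_def by blast
        have "((\<lambda>x. iter_partial js f x $ k) has_derivative D) (at x)"
          by (rule derivative_cong_open(1)[OF S x _ D]) (simp add: that)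
        then show ?thesis by (rule differentiableI)
      qed
      then show "iter_partial js f differentiable (at x)"
        by (subst differentiable_componentwise_within) (auto simp: Basis_vec_def inner_axis)
    qed
    {
      case Nil
      show ?case using comp[of "[]"] by simp
    next
      case (Cons i js)
      have "\<forall>x\<in>S. \<forall>k. iter_partial (i # js) f x $ k = iter_partial (i # js) (\<lambda>x. f x $ k) x"
      proof (intro ballI allI)
        fix x k assume x: "x \<in> S"
        let ?D = "frechet_derivative (iter_partial js f) (at x)"
        have D: "(iter_partial js f has_derivative ?D) (at x)"
          using Cons x frechet_derivative_works by blast
        have "((\<lambda>x. iter_partial js f x $ k) has_derivative (\<lambda>d. ?D d $ k)) (at x)"
          by (rule has_derivative_compose[OF D bounded_linear_imp_has_derivative,
              OF bounded_linear_vec_nth])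
        then have "frechet_derivative (iter_partial js (\<lambda>x. f x $ k)) (at x) = (\<lambda>d. ?D d $ k)"
          using Cons by (intro derivative_cong_open(2)[OF S x]) auto
        then show "iter_partial (i # js) f x $ k = iter_partial (i # js) (\<lambda>x. f x $ k) x"
          by simp
      qed
      with comp[OF this] show ?case by blast
    }
  qed
  then show ?thesis by (simp add: smooth_on_def)
qed

section \<open>Smooth convergence along solutions\<close>

text \<open>
  The function \<open>F\<close> need not be uniformly continuous on \<open>Q\<close>, but it is so on a closed tubular neighbourhood
  of the compact set \<open>l ` K\<close>, where the approximations eventually take their values.
\<close>

lemma uniform_limit_continuous_compose:
  fixes F :: "'a::heine_borel \<Rightarrow> 'b::metric_space"
  assumes F: "continuous_on Q F" "open Q" and K: "compact K" "continuous_on K l" "l ` K \<subseteq> Q"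
    and lim: "uniform_limit K f l \<F>"
  shows "uniform_limit K (\<lambda>i x. F (f i x)) (\<lambda>x. F (l x)) \<F>"
proof -
  have lK: "compact (l ` K)"
    using K by (intro compact_continuous_image)
  from compact_subset_open_imp_cball_epsilon_subset[OF this F(2) K(3)]
  obtain e where e: "e > 0" "(\<Union>x\<in>l ` K. cball x e) \<subseteq> Q" .
  let ?C = "\<Union>x\<in>l ` K. cball x e"
  have C: "compact ?C"
    by (rule compact_minkowski_sum_cball[OF lK])
  show ?thesis
  proof (rule uniform_limit_compose_uniformly_continuous_on[OF lim])
    show "uniformly_continuous_on ?C F"
      using C e F(1) by (intro compact_uniformly_continuous) (auto intro: continuous_on_subset)
    show "\<forall>\<^sub>F i in \<F>. \<forall>y\<in>K. f i y \<in> ?C"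
      using uniform_limitD[OF lim e(1)]
      by eventually_elim (force simp: dist_commute intro: less_imp_le)
    show "closed ?C"
      using C by (rule compact_imp_closed)
  qed
qed

lemma smooth_on_pullback:
  assumes "elementary W g" and "\<And>i k. elementary W (\<lambda>a v. M a v $ i $ k)" and "solves W M a U s"
  shows "smooth_on U (\<lambda>x. g a (s x))"
  unfolding smooth_on_def
proof
  fix js show "\<forall>x\<in>U. iter_partial js (\<lambda>x. g a (s x)) differentiable (at x)"
    using elementary_pullback[OF assms(1,2), of js] assms(3) by (elim exE conjE) auto
qed

lemma solves_id: "open W \<Longrightarrow> a > 0 \<Longrightarrow> solves W (\<lambda>a v. mat 1) a W (\<lambda>x. x)"
  by (simp add: solves_def)

lemma elementary_mat_1: "elementary W (\<lambda>a v. mat 1 $ i $ k)"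
  by (rule elementary.const)

text \<open>
  The reason why uniform convergence of the solutions suffices for convergence of all derivatives:
  each derivative is one fixed continuous function evaluated at the pair of parameter and solution.
\<close>

lemma smooth_loc_limit_pullback:
  assumes g: "elementary W g" and M: "\<And>i k. elementary W (\<lambda>a v. M a v $ i $ k)"
    and W: "open W"
    and s: "\<forall>\<^sub>F i in \<F>. solves W M (a i) U (s i)" and s0: "solves W M a0 U s0"
    and a: "(a \<longlongrightarrow> a0) \<F>" and lim: "uniform_limit U s s0 \<F>"
    and f: "\<forall>\<^sub>F i in \<F>. f i = (\<lambda>x. g (a i) (s i x))" and f0: "f0 = (\<lambda>x. g a0 (s0 x))"
  shows "smooth_loc_limit U f f0 \<F>"
  unfolding smooth_loc_limit_def
proof (intro conjI allI impI)
  note smooth = smooth_on_pullback[OF g M]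
  show "smooth_on U f0"
    unfolding f0 by (rule smooth[OF s0])
  show "\<forall>\<^sub>F i in \<F>. smooth_on U (f i)"
    using s f by eventually_elim (simp add: smooth)
  fix K js assume K: "compact K \<and> K \<subseteq> U"
  obtain h where h: "elementary W h" and "\<forall>a U s. solves W M a U s \<longrightarrow>
      (\<forall>x\<in>U. iter_partial js (\<lambda>x. g a (s x)) differentiable (at x) \<and>
        iter_partial js (\<lambda>x. g a (s x)) x = h a (s x))"
    using elementary_pullback[OF g M, of js] by (elim exE conjE)
  then have h_eq: "iter_partial js (\<lambda>x. g a (s x)) x = h a (s x)"
    if "solves W M a U s" "x \<in> K" for a s x
    using that K by (auto dest!: subsetD)
  have cont: "continuous_on K s0"
    using s0 K unfolding solves_def
    by (meson has_derivative_continuous continuous_at_imp_continuous_on subsetD)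
  have "uniform_limit K (\<lambda>i x. (a i, s i x)) (\<lambda>x. (a0, s0 x)) \<F>"
  proof (rule uniform_limitI)
    fix e :: real assume "e > 0"
    then have "\<forall>\<^sub>F i in \<F>. dist (a i) a0 < e / 2" "\<forall>\<^sub>F i in \<F>. \<forall>x\<in>U. dist (s i x) (s0 x) < e / 2"
      using tendstoD[OF a, of "e / 2"] uniform_limitD[OF lim, of "e / 2"] by simp_all
    then show "\<forall>\<^sub>F i in \<F>. \<forall>x\<in>K. dist (a i, s i x) (a0, s0 x) < e"
    proof eventually_elim
      case (elim i)
      show ?case
      proof
        fix x assume "x \<in> K"
        then have "dist (s i x) (s0 x) < e / 2"
          using elim K by auto
        with elim sqrt_sum_squares_le_sum[of "dist (a i) a0" "dist (s i x) (s0 x)"]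
        show "dist (a i, s i x) (a0, s0 x) < e"
          by (simp add: dist_Pair_Pair)
      qed
    qed
  qed
  then have "uniform_limit K (\<lambda>i x. (\<lambda>(a, v). h a v) (a i, s i x))
      (\<lambda>x. (\<lambda>(a, v). h a v) (a0, s0 x)) \<F>"
  proof (rule uniform_limit_continuous_compose[OF elementary_continuous[OF h], rotated -1])
    show "open ({0::real<..} \<times> W)"
      using W by (intro open_Times open_greaterThan)
    show "compact K" "continuous_on K (\<lambda>x. (a0, s0 x))"
      "(\<lambda>x. (a0, s0 x)) ` K \<subseteq> {0<..} \<times> W"
      using W K s0 cont by (auto simp: solves_def intro!: continuous_intros)
  qed
  then have "uniform_limit K (\<lambda>i x. h (a i) (s i x)) (\<lambda>x. h a0 (s0 x)) \<F>"
    by simp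
  also have "?this \<longleftrightarrow> uniform_limit K (\<lambda>i. iter_partial js (f i)) (iter_partial js f0) \<F>"
  proof (rule uniform_limit_cong)
    show "\<forall>\<^sub>F i in \<F>. \<forall>x\<in>K. h (a i) (s i x) = iter_partial js (f i) x"
      using s f by eventually_elim (simp add: h_eq)
    show "h a0 (s0 x) = iter_partial js f0 x" if "x \<in> K" for x
      using that s0 by (simp add: f0 h_eq)
  qed
  finally show "uniform_limit K (\<lambda>i. iter_partial js (f i)) (iter_partial js f0) \<F>" .
qed

section \<open>The charts and their inverse Jacobian\<close>

text \<open>
  The angle enters \<open>X_map\<close> only through $a = 1/\cos^2\varepsilon$, in which it is affine.
\<close>

definition X_model :: "real \<Rightarrow> real \<Rightarrow> real^3 \<Rightarrow> real^3" where
  "X_model b a v = vector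
    [((v $ 1)\<^sup>2 + (v $ 2)\<^sup>2) / 2 - b * a / 2 * (sinh (v $ 3))\<^sup>2,
     sqrt b * cosh (v $ 3) * v $ 1,
     sqrt b * sinh (v $ 3) * v $ 2]"

definition X_jac :: "real \<Rightarrow> real \<Rightarrow> real^3 \<Rightarrow> real^3^3" where
  "X_jac b a v = vector
    [vector [v $ 1, v $ 2, - b * a * sinh (v $ 3) * cosh (v $ 3)],
     vector [sqrt b * cosh (v $ 3), 0, sqrt b * sinh (v $ 3) * v $ 1],
     vector [0, sqrt b * sinh (v $ 3), sqrt b * cosh (v $ 3) * v $ 2]]"

lemma X_map_eq: "X_map b \<epsilon> = X_model b (1 / (cos \<epsilon>)\<^sup>2)"
  by (simp add: fun_eq_iff X_map_def X_model_def Let_def mult.commute)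

lemma X_model_nth_has_derivative:
  "((\<lambda>w. X_model b a w $ j) has_derivative (\<lambda>d. (X_jac b a v *v d) $ j)) (at v)"
proof -
  have "\<forall>j. ((\<lambda>w. X_model b a w $ j) has_derivative (\<lambda>d. (X_jac b a v *v d) $ j)) (at v)"
    unfolding forall_3 X_model_def X_jac_def vector_3 matrix_vector_mult_def vec_lambda_beta sum_3
    by (intro conjI; rule has_derivative_eq_rhs,
        (rule derivative_intros nth_derivatives | (simp; fail))+)
      (auto simp: fun_eq_iff field_simps power2_eq_square)
  then show ?thesis by blast
qed

lemma X_model_has_derivative:
  "(X_model b a has_derivative (\<lambda>d. X_jac b a v *v d)) (at v)"
  by (subst has_derivative_componentwise_within)
    (auto simp: Basis_vec_def inner_axis X_model_nth_has_derivative)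

definition off_axis :: "(real^3) set" where
  "off_axis = {v. v $ 2 \<noteq> 0 \<or> v $ 3 \<noteq> 0}"

text \<open>
  The Jacobian determinant of \<open>X_model\<close> is $-b$ times this.
\<close>

definition jac_factor :: "real \<Rightarrow> real \<Rightarrow> real^3 \<Rightarrow> real" where
  "jac_factor b a v = (sinh (v $ 3))\<^sup>2 * (v $ 1)\<^sup>2 + (cosh (v $ 3))\<^sup>2 * (v $ 2)\<^sup>2
     + b * a * (sinh (v $ 3))\<^sup>2 * (cosh (v $ 3))\<^sup>2"

definition inv_jac :: "real \<Rightarrow> real \<Rightarrow> real^3 \<Rightarrow> real^3^3" where
  "inv_jac b a v = (1 / jac_factor b a v) *\<^sub>R vector
    [vector [(sinh (v $ 3))\<^sup>2 * v $ 1,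
       (cosh (v $ 3) * (v $ 2)\<^sup>2 + b * a * (sinh (v $ 3))\<^sup>2 * cosh (v $ 3)) / sqrt b,
       - (sinh (v $ 3) * v $ 1 * v $ 2 / sqrt b)],
     vector [(cosh (v $ 3))\<^sup>2 * v $ 2,
       - (cosh (v $ 3) * v $ 1 * v $ 2 / sqrt b),
       (sinh (v $ 3) * (v $ 1)\<^sup>2 + b * a * sinh (v $ 3) * (cosh (v $ 3))\<^sup>2) / sqrt b],
     vector [- (sinh (v $ 3) * cosh (v $ 3)),
       sinh (v $ 3) * v $ 1 / sqrt b,
       cosh (v $ 3) * v $ 2 / sqrt b]]"

lemma open_off_axis: "open off_axis"
  unfolding off_axis_def by (intro open_Collect_disj open_Collect_neq continuous_intros)

lemma jac_factor_pos:
  assumes "b > 0" "a > 0" "v \<in> off_axis"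
  shows "jac_factor b a v > 0"
proof (cases "v $ 3 = 0")
  case True
  then show ?thesis using assms by (auto simp: jac_factor_def off_axis_def)
next
  case False
  then have "b * a * (sinh (v $ 3))\<^sup>2 * (cosh (v $ 3))\<^sup>2 > 0"
    using assms by simp
  then show ?thesis
    unfolding jac_factor_def by (intro add_nonneg_pos) auto
qed

lemma inv_jac_inverse:
  assumes "b > 0" "a > 0" "v \<in> off_axis"
  shows "inv_jac b a v *v (X_jac b a v *v d) = d"
proof -
  obtain r where r: "r > 0" "b = r * r" "sqrt b = r"
    using assms by (metis real_sqrt_gt_0_iff real_sqrt_mult_self abs_of_pos)
  have D: "jac_factor b a v \<noteq> 0"
    using jac_factor_pos[OF assms] by simp
  have "inv_jac b a v ** X_jac b a v = mat 1"
    unfolding vec_eq_iff forall_3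
    using D r(1)
    by (simp add: inv_jac_def X_jac_def matrix_matrix_mult_def sum_3 mat_def r(3) field_simps)
      (auto simp: jac_factor_def r(2) algebra_simps power2_eq_square)
  then show ?thesis
    by (simp add: matrix_vector_mul_assoc)
qed

lemma elementary_inv_jac:
  assumes "b > 0"
  shows "elementary off_axis (\<lambda>a v. inv_jac b a v $ i $ k)"
proof -
  have D: "elementary off_axis (\<lambda>a v. 1 / jac_factor b a v)"
    using jac_factor_pos[OF assms] unfolding jac_factor_def
    by (intro elementary_intros) force
  have b: "elementary off_axis (\<lambda>a v. x a v / sqrt b)" if "elementary off_axis x" for x
    using elementary.mult[OF elementary.const[of _ "1 / sqrt b"] that] by simp
  have "\<forall>i k. elementary off_axis (\<lambda>a v. inv_jac b a v $ i $ k)"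
    unfolding forall_3 inv_jac_def vector_scaleR_component vector_3 real_scaleR_def
    by (intro conjI elementary.mult[OF D] b elementary_intros)
  then show ?thesis by blast
qed

text \<open>
  A merely continuous right inverse of the chart is differentiable, since the Jacobian is invertible off
  the axis, and its derivative is the inverse Jacobian.
\<close>

lemma solves_inverse:
  assumes "b > 0" "a > 0" "open U" "s ` U \<subseteq> off_axis"
    and "continuous_on U s" "\<And>x. x \<in> U \<Longrightarrow> X_model b a (s x) = x"
  shows "solves off_axis (inv_jac b) a U s"
  unfolding solves_def
proof (intro conjI ballI assms)
  fix x assume x: "x \<in> U"
  show "(s has_derivative (\<lambda>d. inv_jac b a (s x) *v d)) (at x)"
  proof (rule has_derivative_inverse_basic[OF X_model_has_derivative])
    show "(*v) (inv_jac b a (s x)) \<circ> (*v) (X_jac b a (s x)) = id"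
      using x assms by (auto simp: fun_eq_iff inv_jac_inverse)
    show "continuous (at x) s"
      using assms x by (simp add: continuous_on_eq_continuous_at)
  qed (use assms x in \<open>auto intro: matrix_vector_mul_bounded_linear\<close>)
qed

section \<open>The graph potential in closed form\<close>

text \<open>
  Integrating $\sum_j Y_j\,dX_j$ gives $-b\tan\varepsilon$ times this function with
  $a = 1/\cos^2\varepsilon$: integrate the coefficients of $dp$ and $dq$, which are linear in \<open>p\<close> and \<open>q\<close>,
  and then the remaining $-ba\,\tau\sinh\tau\cosh\tau\,d\tau$ by parts.
\<close>

definition rescaled_potential :: "real \<Rightarrow> real \<Rightarrow> real^3 \<Rightarrow> real" where
  "rescaled_potential b a v =
     (v $ 1)\<^sup>2 * ((v $ 3 - sinh (v $ 3) * cosh (v $ 3)) * (1 / 2))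
   + (v $ 2)\<^sup>2 * ((v $ 3 + sinh (v $ 3) * cosh (v $ 3)) * (1 / 2))
   - b * a * (v $ 3 * (sinh (v $ 3))\<^sup>2 * (1 / 2) - (sinh (v $ 3) * cosh (v $ 3) - v $ 3) * (1 / 4))"

lemma elementary_potential: "elementary W (rescaled_potential b)"
  unfolding rescaled_potential_def by (intro elementary_intros)

lemma potential_has_derivative:
  "(rescaled_potential b a has_derivative (\<lambda>d.
      v $ 1 * (v $ 3 - sinh (v $ 3) * cosh (v $ 3)) * d $ 1
    + v $ 2 * (v $ 3 + sinh (v $ 3) * cosh (v $ 3)) * d $ 2
    + ((v $ 2)\<^sup>2 * (cosh (v $ 3))\<^sup>2 - (v $ 1)\<^sup>2 * (sinh (v $ 3))\<^sup>2
        - b * a * v $ 3 * sinh (v $ 3) * cosh (v $ 3)) * d $ 3)) (at v)"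
proof -
  \<comment> \<open>The derivative as the product rule gives it; $\cosh^2 = 1 + \sinh^2$ then brings it to the stated form.\<close>
  have "(rescaled_potential b a has_derivative (\<lambda>d.
      v $ 1 * (v $ 3 - sinh (v $ 3) * cosh (v $ 3)) * d $ 1
    + v $ 2 * (v $ 3 + sinh (v $ 3) * cosh (v $ 3)) * d $ 2
    + ((v $ 1)\<^sup>2 * ((1 - (cosh (v $ 3))\<^sup>2 - (sinh (v $ 3))\<^sup>2) / 2)
        + (v $ 2)\<^sup>2 * ((1 + (cosh (v $ 3))\<^sup>2 + (sinh (v $ 3))\<^sup>2) / 2)
        - b * a * ((sinh (v $ 3))\<^sup>2 / 2 + v $ 3 * sinh (v $ 3) * cosh (v $ 3)
          - ((cosh (v $ 3))\<^sup>2 + (sinh (v $ 3))\<^sup>2 - 1) / 4)) * d $ 3)) (at v)"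
    unfolding rescaled_potential_def
    by (rule has_derivative_eq_rhs, (rule derivative_intros nth_derivatives | (simp; fail))+)
      (simp add: fun_eq_iff field_simps power2_eq_square)
  then show ?thesis
    by (rule has_derivative_eq_rhs) (simp add: cosh_square_eq fun_eq_iff field_simps)
qed

lemma is_graph_potential:
  "is_graph_potential b \<epsilon> (\<lambda>v. - b * tan \<epsilon> * rescaled_potential b (1 / (cos \<epsilon>)\<^sup>2) v)" if b: "b > 0"
  unfolding is_graph_potential_def
proof (intro conjI allI impI)
  fix v
  obtain r where r: "b = r * r" "sqrt (r * r) = r"
  proof
    show "b = sqrt b * sqrt b" "sqrt (sqrt b * sqrt b) = sqrt b"
      using b by simp_all
  qed
  define a where "a = 1 / (cos \<epsilon>)\<^sup>2"
  have X: "frechet_derivative (\<lambda>w. X_map b \<epsilon> w $ j) (at v) = (\<lambda>d. (X_jac b a v *v d) $ j)" for j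
    unfolding X_map_eq a_def using frechet_derivative_at[OF X_model_nth_has_derivative] by metis
  show "((\<lambda>v. - b * tan \<epsilon> * rescaled_potential b (1 / (cos \<epsilon>)\<^sup>2) v) has_derivative (\<lambda>h. \<Sum>j\<in>UNIV. Y_map b \<epsilon> v $ j *
      frechet_derivative (\<lambda>w. X_map b \<epsilon> w $ j) (at v) h)) (at v)"
    unfolding X a_def[symmetric]
    by (rule has_derivative_eq_rhs[OF has_derivative_mult_right[OF potential_has_derivative]])
      (simp only: fun_eq_iff sum_3 X_jac_def Y_map_def matrix_vector_mult_def Let_def vector_3
        vec_lambda_beta r, simp add: power2_eq_square algebra_simps)
next
  fix v :: "real^3" assume "v $ 2 = 0 \<and> v $ 3 = 0"
  then show "- b * tan \<epsilon> * rescaled_potential b (1 / (cos \<epsilon>)\<^sup>2) v = 0"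
    by (simp add: rescaled_potential_def)
qed

lemma graph_potential_unique:
  assumes "is_graph_potential b \<epsilon> G" "is_graph_potential b \<epsilon> H"
  shows "G = H"
proof
  fix v
  have "((\<lambda>v. G v - H v) has_derivative (\<lambda>h. 0)) (at w)" for w
  proof (rule has_derivative_eq_rhs[OF has_derivative_diff])
    show "(G has_derivative (\<lambda>h. \<Sum>j\<in>UNIV. Y_map b \<epsilon> w $ j *
        frechet_derivative (\<lambda>w. X_map b \<epsilon> w $ j) (at w) h)) (at w)"
      "(H has_derivative (\<lambda>h. \<Sum>j\<in>UNIV. Y_map b \<epsilon> w $ j *
        frechet_derivative (\<lambda>w. X_map b \<epsilon> w $ j) (at w) h)) (at w)"
      using assms unfolding is_graph_potential_def by blast+
  qed simp
  then obtain c where "\<And>v. G v - H v = c"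
    using has_derivative_zero_constant[of UNIV "\<lambda>v. G v - H v"] by auto
  from this[of v] this[of 0] show "G v = H v"
    using assms unfolding is_graph_potential_def by simp
qed

lemma graph_potential_eq:
  "b > 0 \<Longrightarrow> graph_potential b \<epsilon> = (\<lambda>v. - b * tan \<epsilon> * rescaled_potential b (1 / (cos \<epsilon>)\<^sup>2) v)"
  unfolding graph_potential_def
  by (intro the_equality is_graph_potential graph_potential_unique[OF _ is_graph_potential])

text \<open>
  The rescaling cancels the factor $-b\tan\varepsilon$ exactly, so the rescaled potential depends on
  $\varepsilon$ only through \<open>a\<close>, and its limit is the value at $a = 1$.
\<close>

lemma rescaled_graph_potential:
  assumes "b > 0" "sin \<epsilon> \<noteq> 0" "cos \<epsilon> \<noteq> 0"
  shows "- (cot \<epsilon> / b) * graph_potential b \<epsilon> v = rescaled_potential b (1 / (cos \<epsilon>)\<^sup>2) v"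
  using assms by (simp add: graph_potential_eq tan_def cot_def)

section \<open>The limit function in closed form\<close>

lemma interval_integral_antiderivative:
  fixes f F :: "real \<Rightarrow> real"
  assumes "\<And>x. (F has_field_derivative f x) (at x)" "continuous_on UNIV f"
  shows "(LBINT x=ereal a..ereal b. f x) = F b - F a"
  using assms
  by (intro interval_integral_FTC_finite)
    (auto intro: continuous_on_subset has_field_derivative_at_within
      simp flip: has_real_derivative_iff_has_vector_derivative)

context
  fixes b :: real
  assumes b: "b > 0"
begin

lemma sqrt_b_sq: "b + v\<^sup>2 > 0" "sqrt (b + v\<^sup>2) > 0" "sqrt (b + v\<^sup>2) \<noteq> 0"
  "sqrt (b + v\<^sup>2) * sqrt (b + v\<^sup>2) = b + v\<^sup>2"
proof -
  show "b + v\<^sup>2 > 0" using b by (intro add_pos_nonneg) auto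
  then show "sqrt (b + v\<^sup>2) > 0" "sqrt (b + v\<^sup>2) \<noteq> 0" "sqrt (b + v\<^sup>2) * sqrt (b + v\<^sup>2) = b + v\<^sup>2"
    by auto
qed

lemma sqrt_b_sinh: "sqrt (b + (sqrt b * sinh \<tau>)\<^sup>2) = sqrt b * cosh \<tau>"
proof -
  have "b + (sqrt b * sinh \<tau>)\<^sup>2 = (sqrt b * cosh \<tau>)\<^sup>2"
    using b by (simp add: power_mult_distrib cosh_square_eq algebra_simps)
  then show ?thesis using b by simp
qed

lemma arsinh_scaled_derivative:
  "((\<lambda>v. arsinh (v / sqrt b)) has_field_derivative 1 / sqrt (b + v\<^sup>2)) (at v)"
proof -
  have "b * ((v / sqrt b)\<^sup>2 + 1) = b + v\<^sup>2"
    using b by (simp add: power_divide field_simps)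
  then have "sqrt b * sqrt ((v / sqrt b)\<^sup>2 + 1) = sqrt (b + v\<^sup>2)"
    by (metis real_sqrt_mult)
  then have "1 / sqrt ((v / sqrt b)\<^sup>2 + 1) * (1 / sqrt b) = 1 / sqrt (b + v\<^sup>2)"
    by (simp add: mult.commute)
  then show ?thesis
    using DERIV_chain2[OF arsinh_real_has_field_derivative DERIV_cdivide[OF DERIV_ident]]
    by metis
qed

lemma sqrt_derivative:
  "((\<lambda>v. sqrt (b + v\<^sup>2)) has_field_derivative v / sqrt (b + v\<^sup>2)) (at v)"
  using sqrt_b_sq[of v] by (auto intro!: derivative_eq_intros simp: field_simps)

lemma f1_sinh: "f1 b (sqrt b * sinh \<tau>) = \<tau>"
proof -
  have "f1 b (sqrt b * sinh \<tau>) = arsinh (sqrt b * sinh \<tau> / sqrt b) - arsinh (0 / sqrt b)"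
    unfolding f1_def using sqrt_b_sq
    by (intro interval_integral_antiderivative arsinh_scaled_derivative continuous_intros) auto
  then show ?thesis using b by (simp add: arsinh_sinh_real)
qed

lemma f2_sinh: "f2 b (sqrt b * sinh \<tau>) = b * (sinh \<tau> * cosh \<tau> - \<tau>) / 2"
proof -
  define F where "F = (\<lambda>v. (v * sqrt (b + v\<^sup>2) - b * arsinh (v / sqrt b)) / 2)"
  have "(F has_field_derivative v\<^sup>2 / sqrt (b + v\<^sup>2)) (at v)" for v
    unfolding F_def
    by (rule DERIV_cong, (rule derivative_intros arsinh_scaled_derivative sqrt_derivative | (simp; fail))+)
      (use sqrt_b_sq[of v] in \<open>simp add: field_simps power2_eq_square\<close>)
  then have "f2 b (sqrt b * sinh \<tau>) = F (sqrt b * sinh \<tau>) - F 0"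
    unfolding f2_def using sqrt_b_sq
    by (intro interval_integral_antiderivative continuous_intros) auto
  also have "\<dots> = ((sqrt b * sqrt b) * sinh \<tau> * cosh \<tau> - b * arsinh (sqrt b * sinh \<tau> / sqrt b)) / 2"
    unfolding F_def sqrt_b_sinh by simp
  finally show ?thesis using b by (simp add: arsinh_sinh_real right_diff_distrib)
qed

text \<open>
  The substitution $v = \sqrt b \sinh u$ turns the integrand into $4/(b^2\cosh^2 2u)$, with
  antiderivative $(2/b^2)\tanh 2u$; written back in \<open>v\<close> this is the algebraic function \<open>F\<close> in the proof.
\<close>

lemma f3_sinh: "f3 b (sqrt b * sinh \<tau>) = 4 / b\<^sup>2 * (sinh \<tau> * cosh \<tau> / (1 + 2 * (sinh \<tau>)\<^sup>2))"
proof -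
  define F where "F = (\<lambda>v. 4 / b\<^sup>2 * (v * sqrt (b + v\<^sup>2) / (b + 2 * v\<^sup>2)))"
  have pos: "b + 2 * v\<^sup>2 > 0" "v\<^sup>2 + b / 2 > 0" for v
    using b by (auto intro: add_pos_nonneg add_nonneg_pos)
  have "(F has_field_derivative 1 / ((v\<^sup>2 + b / 2)\<^sup>2 * sqrt (b + v\<^sup>2))) (at v)" for v
  proof -
    define r where "r = sqrt (b + v\<^sup>2)"
    have r: "r > 0" "b = r\<^sup>2 - v\<^sup>2"
      using sqrt_b_sq[of v] by (auto simp: r_def)
    have eq: "(v\<^sup>2 + b / 2)\<^sup>2 = (b + 2 * v\<^sup>2)\<^sup>2 / 4"
      by (simp add: power2_eq_square field_simps)
    have "4 / b\<^sup>2 * (((1 * r + v * (v / r)) * (b + 2 * v\<^sup>2) - v * r * (4 * v))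
        / ((b + 2 * v\<^sup>2) * (b + 2 * v\<^sup>2))) = 1 / ((v\<^sup>2 + b / 2)\<^sup>2 * r)"
    proof -
      have "((1 * r + v * (v / r)) * (b + 2 * v\<^sup>2) - v * r * (4 * v)) * r = b\<^sup>2"
        using r(1) by (simp add: field_simps r(2)) (simp add: power2_eq_square algebra_simps)
      then have "(1 * r + v * (v / r)) * (b + 2 * v\<^sup>2) - v * r * (4 * v) = b\<^sup>2 / r"
        by (rule eq_divide_imp[rotated]) (use r(1) in simp)
      then show ?thesis
        unfolding eq using r(1) b by (simp add: power2_eq_square)
    qed
    moreover have "(F has_field_derivative 4 / b\<^sup>2 * (((1 * r + v * (v / r)) * (b + 2 * v\<^sup>2) - v * r * (4 * v))
        / ((b + 2 * v\<^sup>2) * (b + 2 * v\<^sup>2)))) (at v)"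
      unfolding F_def r_def
      by (rule DERIV_cong, (rule derivative_intros sqrt_derivative | (use pos[of v] in \<open>simp; fail\<close>))+)
        (simp add: algebra_simps)
    ultimately show ?thesis by (simp add: r_def)
  qed
  then have "f3 b (sqrt b * sinh \<tau>) = F (sqrt b * sinh \<tau>) - F 0"
    unfolding f3_def using sqrt_b_sq pos
    by (intro interval_integral_antiderivative continuous_intros)
      (auto simp: less_imp_neq[OF pos(2), symmetric])
  also have "\<dots> = 4 / b\<^sup>2 * ((sqrt b * sqrt b) * (sinh \<tau> * cosh \<tau>)
      / ((sqrt b * sqrt b) * (1 + 2 * (sinh \<tau>)\<^sup>2)))"
    using b unfolding F_def sqrt_b_sinh by (simp add: power_mult_distrib algebra_simps)
  finally show ?thesis
    using b by simp
qed

text \<open>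
  On the covering space $P_b$ factors as $-(b^2/8)\cosh 2\tau\,(b + 2p^2 - 2q^2)$, and the first factor
  cancels the denominator of $f_3$.  So the three integrals combine to a polynomial expression
  in \<open>p\<close>, \<open>q\<close>, \<open>\<tau>\<close> and the hyperbolic functions of \<open>\<tau>\<close>.
\<close>

lemma f_cover_eq: "f_cover b = rescaled_potential b 1"
proof
  fix v :: "real^3"
  define p q t s c where "p = v $ 1" "q = v $ 2" "t = v $ 3" "s = sinh t" "c = cosh t"
  have c2: "c\<^sup>2 = s\<^sup>2 + 1"
    by (simp add: p_q_t_s_c_def cosh_square_eq)
  \<comment> \<open>This is $\cosh 2\tau$.\<close>
  have D: "1 + 2 * s\<^sup>2 > 0"
    by (intro add_pos_nonneg) auto
  have "P_poly b (X_map b 0 v) = - (b\<^sup>2 / 8) * (1 + 2 * s\<^sup>2) * (b + 2 * p\<^sup>2 - 2 * q\<^sup>2)"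
    using b c2
    by (simp add: P_poly_def X_map_def Let_def power_mult_distrib flip: p_q_t_s_c_def)
      (simp add: power2_eq_square field_simps)
  moreover have "1 / 2 * (- (b\<^sup>2 / 8) * k * m) * (4 / b\<^sup>2 * (s * c / k)) = - (s * c / 4) * m"
    if "k > 0" for k m
    using that b by (simp add: field_simps)
  ultimately have "1 / 2 * P_poly b (X_map b 0 v) * f3 b (sqrt b * s) = - (s * c / 4) * (b + 2 * p\<^sup>2 - 2 * q\<^sup>2)"
    using D unfolding p_q_t_s_c_def(4) f3_sinh
    unfolding p_q_t_s_c_def(4,5)[symmetric] by (simp only:)
  then show "f_cover b v = rescaled_potential b 1 v"
    unfolding f_cover_def Let_def p_q_t_s_c_def(4)[symmetric] p_q_t_s_c_def(3)[symmetric]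
    by (simp add: f1_sinh f2_sinh p_q_t_s_c_def(4))
      (simp add: rescaled_potential_def X_map_def Let_def field_simps flip: p_q_t_s_c_def)
qed

end

section \<open>Transport of sheets\<close>

text \<open>
  To lift the identity of the base to a map \<open>v \<mapsto> v'\<close> of the covering space with
  $X_\varepsilon(v') = X_0(v)$, put $\sinh\tau' = \sqrt\sigma\sinh\tau$.  The second and third components
  then force \<open>p'\<close> and \<open>q'\<close>, and \<open>ratio_eq\<close> is what remains of the first component, multiplied by two, as an
  equation for $\sigma > 0$.
\<close>

definition ratio_eq :: "real \<Rightarrow> real \<Rightarrow> real^3 \<Rightarrow> real \<Rightarrow> real" where
  "ratio_eq b a v \<sigma> =
     (v $ 1)\<^sup>2 * ((1 + (sinh (v $ 3))\<^sup>2) / (1 + \<sigma> * (sinh (v $ 3))\<^sup>2)) + (v $ 2)\<^sup>2 / \<sigma>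
     - b * a * \<sigma> * (sinh (v $ 3))\<^sup>2
     - ((v $ 1)\<^sup>2 + (v $ 2)\<^sup>2 - b * (sinh (v $ 3))\<^sup>2)"

definition ratio :: "real \<Rightarrow> real \<Rightarrow> real^3 \<Rightarrow> real" where
  "ratio b a v = (SOME \<sigma>. \<sigma> \<in> {1 / a..1} \<and> ratio_eq b a v \<sigma> = 0)"

definition transport :: "real \<Rightarrow> real \<Rightarrow> real^3 \<Rightarrow> real^3" where
  "transport b a v = vector
    [v $ 1 * sqrt ((1 + (sinh (v $ 3))\<^sup>2) / (1 + ratio b a v * (sinh (v $ 3))\<^sup>2)),
     v $ 2 / sqrt (ratio b a v),
     arsinh (sqrt (ratio b a v) * sinh (v $ 3))]"

lemma one_plus_nonneg_mult: "\<sigma> > 0 \<Longrightarrow> 1 + \<sigma> * x\<^sup>2 > (0::real)"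
  by (intro add_pos_nonneg mult_nonneg_nonneg) auto

text \<open>
  The explicit bracket $[1/a, 1]$ carries the quantitative information: it shrinks to $\{1\}$ as $a \to 1$,
  uniformly in the point.
\<close>

lemma ratio_exists:
  assumes "b > 0" "a \<ge> 1"
  shows "\<exists>\<sigma>. \<sigma> \<in> {1 / a..1} \<and> ratio_eq b a v \<sigma> = 0"
proof -
  have "\<exists>\<sigma>\<ge>1 / a. \<sigma> \<le> 1 \<and> ratio_eq b a v \<sigma> = 0"
  proof (rule IVT2')
    let ?s = "(sinh (v $ 3))\<^sup>2"
    have "1 + (1 / a) * ?s \<le> 1 + ?s" and pos: "1 + (1 / a) * ?s > 0"
      using assms one_plus_nonneg_mult[of "1 / a"] by (auto simp: divide_le_eq mult_le_cancel_left1 mult_right_le_one_le)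
    then have "(v $ 1)\<^sup>2 * 1 \<le> (v $ 1)\<^sup>2 * ((1 + ?s) / (1 + (1 / a) * ?s))"
      by (intro mult_left_mono) auto
    moreover have "(v $ 2)\<^sup>2 * 1 \<le> (v $ 2)\<^sup>2 * a"
      using assms by (intro mult_left_mono) auto
    ultimately show "0 \<le> ratio_eq b a v (1 / a)"
      using assms by (simp add: ratio_eq_def)
    have "b * 1 * ?s \<le> b * a * ?s"
      using assms by (intro mult_right_mono mult_left_mono) auto
    moreover have "1 + ?s \<noteq> 0"
      using one_plus_nonneg_mult[of 1 "sinh (v $ 3)"] by simp
    ultimately show "ratio_eq b a v 1 \<le> 0"
      by (simp add: ratio_eq_def)
    show "1 / a \<le> 1" using assms by simp
    have "1 + x * (sinh (v $ 3))\<^sup>2 \<noteq> 0" "x \<noteq> 0" if "x \<in> {1 / a..1}" for x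
    proof -
      have "x > 0" using that assms by (auto intro: less_le_trans[of 0 "1 / a"])
      then show "1 + x * (sinh (v $ 3))\<^sup>2 \<noteq> 0" "x \<noteq> 0"
        using one_plus_nonneg_mult[of x "sinh (v $ 3)"] by auto
    qed
    then show "continuous_on {1 / a..1} (ratio_eq b a v)"
      unfolding ratio_eq_def by (intro continuous_intros) auto
  qed
  then show ?thesis by auto
qed

lemma ratio_eq_strict_antimono:
  assumes "b > 0" "a > 0" "v \<in> off_axis" "0 < \<sigma>" "\<sigma> < \<rho>"
  shows "ratio_eq b a v \<rho> < ratio_eq b a v \<sigma>"
proof -
  let ?s = "(sinh (v $ 3))\<^sup>2"
  have pos: "1 + \<sigma> * ?s > 0"
    using assms by (intro one_plus_nonneg_mult)
  have "1 + \<sigma> * ?s \<le> 1 + \<rho> * ?s"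
    using assms by (intro add_mono mult_right_mono) auto
  then have 1: "(v $ 1)\<^sup>2 * ((1 + ?s) / (1 + \<rho> * ?s)) \<le> (v $ 1)\<^sup>2 * ((1 + ?s) / (1 + \<sigma> * ?s))"
    using pos by (intro mult_left_mono divide_left_mono mult_pos_pos) auto
  have 2: "(v $ 2)\<^sup>2 / \<rho> \<le> (v $ 2)\<^sup>2 / \<sigma>"
    using assms by (intro divide_left_mono mult_pos_pos) auto
  have 3: "b * a * \<sigma> * ?s \<le> b * a * \<rho> * ?s"
    using assms by (intro mult_right_mono mult_left_mono) auto
  have "(v $ 2)\<^sup>2 / \<rho> < (v $ 2)\<^sup>2 / \<sigma> \<or> b * a * \<sigma> * ?s < b * a * \<rho> * ?s"
  proof (cases "v $ 2 = 0")
    case True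
    then have "?s > 0" using assms by (simp add: off_axis_def)
    then show ?thesis
      using assms by (intro disjI2 mult_strict_right_mono mult_strict_left_mono) auto
  next
    case False
    then show ?thesis
      using assms by (intro disjI1 divide_strict_left_mono mult_pos_pos) auto
  qed
  with 1 2 3 show ?thesis
    unfolding ratio_eq_def by linarith
qed

context
  fixes b a :: real
  assumes b: "b > 0" and a: "a \<ge> 1"
begin

lemma ratio_in: "ratio b a v \<in> {1 / a..1}" and ratio_root: "ratio_eq b a v (ratio b a v) = 0"
  using someI_ex[OF ratio_exists[OF b a, of v]] unfolding ratio_def by auto

lemma ratio_pos: "ratio b a v > 0"
  using ratio_in[of v] a by (auto intro: less_le_trans[of 0 "1 / a"])

lemma ratio_unique:
  assumes "v \<in> off_axis" "\<sigma> > 0" "ratio_eq b a v \<sigma> = 0"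
  shows "\<sigma> = ratio b a v"
  using ratio_eq_strict_antimono[OF b _ assms(1), of a] ratio_root[of v] ratio_pos[of v] a assms
  by (metis less_irrefl linorder_less_linear less_le_trans zero_less_one)

text \<open>
  A function into a compact interval is continuous if its graph is closed, and by uniqueness of the root
  the graph is the zero set of a continuous function.
\<close>

lemma continuous_on_ratio: "continuous_on off_axis (ratio b a)"
proof -
  let ?D = "off_axis \<times> {1 / a..1}"
  have pos: "1 + x * (sinh (v $ 3))\<^sup>2 \<noteq> 0" "x \<noteq> 0" if "x \<in> {1 / a..1}" for x and v :: "real^3"
  proof -
    have "x > 0" using that a by (auto intro: less_le_trans[of 0 "1 / a"])
    then show "1 + x * (sinh (v $ 3))\<^sup>2 \<noteq> 0" "x \<noteq> 0"
      using one_plus_nonneg_mult[of x "sinh (v $ 3)"] by auto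
  qed
  have "continuous_on ?D (\<lambda>z. ratio_eq b a (fst z) (snd z))"
    unfolding ratio_eq_def using pos by (intro continuous_intros) auto
  then have "closedin (top_of_set ?D) {z \<in> ?D. ratio_eq b a (fst z) (snd z) = 0}"
    by (rule continuous_closedin_preimage_constant)
  also have "{z \<in> ?D. ratio_eq b a (fst z) (snd z) = 0} = (\<lambda>v. (v, ratio b a v)) ` off_axis"
  proof (intro equalityI subsetI)
    fix z assume z: "z \<in> {z \<in> ?D. ratio_eq b a (fst z) (snd z) = 0}"
    then have "snd z > 0"
      using a by (auto intro: less_le_trans[of 0 "1 / a"])
    with z show "z \<in> (\<lambda>v. (v, ratio b a v)) ` off_axis"
      using ratio_unique[of "fst z" "snd z"] by (auto simp: image_iff prod_eq_iff)
  qed (use ratio_in ratio_root in auto)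
  finally show ?thesis
    using ratio_in by (subst continuous_closed_graph_eq[of "{1 / a..1}"]) auto
qed

lemma X_model_transport: "X_model b a (transport b a v) = X_model b 1 v"
proof -
  define \<sigma> s where "\<sigma> = ratio b a v" and "s = sinh (v $ 3)"
  have \<sigma>: "\<sigma> > 0" using ratio_pos by (simp add: \<sigma>_def)
  have pos: "1 + \<sigma> * s\<^sup>2 > 0" "1 + s\<^sup>2 > 0"
    using one_plus_nonneg_mult[OF \<sigma>] one_plus_nonneg_mult[of 1] by auto
  have root: "(v $ 1)\<^sup>2 * ((1 + s\<^sup>2) / (1 + \<sigma> * s\<^sup>2)) + (v $ 2)\<^sup>2 / \<sigma> - b * a * (\<sigma> * s\<^sup>2)
      = (v $ 1)\<^sup>2 + (v $ 2)\<^sup>2 - b * s\<^sup>2"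
    using ratio_root[of v] by (simp add: ratio_eq_def flip: \<sigma>_def s_def)
  have root': "((v $ 1)\<^sup>2 * (1 + s\<^sup>2) / (1 + \<sigma> * s\<^sup>2) + (v $ 2)\<^sup>2 / \<sigma>) / 2 - b * a * (\<sigma> * s\<^sup>2) / 2
      = ((v $ 1)\<^sup>2 + (v $ 2)\<^sup>2) / 2 - b * s\<^sup>2 / 2"
    using root by (simp flip: add_divide_distrib diff_divide_distrib)
  have cosh: "cosh (arsinh (sqrt \<sigma> * s)) = sqrt (1 + \<sigma> * s\<^sup>2)" "cosh (v $ 3) = sqrt (1 + s\<^sup>2)"
    using \<sigma> cosh_arsinh_real[of "sqrt \<sigma> * s"] cosh_arsinh_real[of s]
    by (auto simp: s_def arsinh_sinh_real power_mult_distrib add.commute)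
  show ?thesis
    unfolding X_model_def transport_def vector_3 sinh_arsinh_real cosh(2)
    unfolding \<sigma>_def[symmetric] s_def[symmetric] cosh(1)
    using root' \<sigma> pos
    by (simp add: power_mult_distrib power_divide real_sqrt_divide mult_ac)
qed

lemma transport_off_axis: "v \<in> off_axis \<Longrightarrow> transport b a v \<in> off_axis"
  using ratio_pos[of v] by (auto simp: off_axis_def transport_def)

lemma continuous_on_transport: "continuous_on off_axis (transport b a)"
proof -
  have "1 + ratio b a v * (sinh (v $ 3))\<^sup>2 \<noteq> 0" "ratio b a v \<noteq> 0" for v
    using one_plus_nonneg_mult[OF ratio_pos, of v "sinh (v $ 3)"] ratio_pos[of v] by auto
  moreover have "continuous_on off_axis (\<lambda>v. arsinh (sqrt (ratio b a v) * sinh (v $ 3)))"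
    by (rule continuous_on_compose2[OF continuous_on_arsinh[of UNIV]])
      (auto intro!: continuous_intros continuous_on_ratio)
  ultimately have "\<forall>i. continuous_on off_axis (\<lambda>v. transport b a v $ i)"
    unfolding forall_3 transport_def vector_3
    by (intro conjI continuous_intros continuous_on_ratio) auto
  then show ?thesis
    by (subst continuous_on_componentwise) (auto simp: Basis_vec_def inner_axis)
qed

text \<open>
  Each coordinate changes by a factor between $1/\sqrt a$ and $\sqrt a$ (for the third one this concerns
  $\sinh\tau$, and arsinh is 1-Lipschitz), and $1 - 1/\sqrt a \le \sqrt a - 1$.
\<close>

lemma transport_dist:
  "dist (transport b a v) v \<le> (sqrt a - 1) * (\<bar>v $ 1\<bar> + \<bar>v $ 2\<bar> + \<bar>sinh (v $ 3)\<bar>)"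
proof -
  define \<sigma> s where "\<sigma> = ratio b a v" and "s = sinh (v $ 3)"
  have \<sigma>: "\<sigma> > 0" "\<sigma> \<le> 1" "1 / \<sigma> \<le> a"
    using ratio_pos[of v] ratio_in[of v] a by (auto simp: \<sigma>_def field_simps)
  have pos: "1 + \<sigma> * s\<^sup>2 > 0"
    using one_plus_nonneg_mult[OF \<sigma>(1)] .
  have "\<sigma> * s\<^sup>2 \<le> 1 * s\<^sup>2"
    using \<sigma> by (intro mult_right_mono) auto
  then have "1 \<le> (1 + s\<^sup>2) / (1 + \<sigma> * s\<^sup>2)"
    using pos by simp
  moreover have "(1 + s\<^sup>2) / (1 + \<sigma> * s\<^sup>2) \<le> 1 / \<sigma>"
    using pos \<sigma> by (simp add: field_simps)
  ultimately have r1: "\<bar>sqrt ((1 + s\<^sup>2) / (1 + \<sigma> * s\<^sup>2)) - 1\<bar> \<le> sqrt a - 1"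
    using \<sigma> by (auto simp: abs_if real_sqrt_le_iff intro: order_trans)
  have "1 / sqrt \<sigma> \<le> sqrt a" "1 \<le> 1 / sqrt \<sigma>"
    using \<sigma> by (auto simp flip: real_sqrt_divide) (metis real_sqrt_divide real_sqrt_le_mono real_sqrt_one)
  then have r2: "\<bar>1 / sqrt \<sigma> - 1\<bar> \<le> sqrt a - 1"
    by simp
  \<comment> \<open>Hence $1 - \sqrt\sigma \le 1/\sqrt\sigma - 1$.\<close>
  have "2 \<le> sqrt \<sigma> + 1 / sqrt \<sigma>"
    using \<sigma> sum_squares_ge_zero[of "sqrt \<sigma> - 1" 0] by (simp add: field_simps)
  then have r3: "\<bar>sqrt \<sigma> - 1\<bar> \<le> sqrt a - 1"
    using \<sigma> a \<open>1 / sqrt \<sigma> \<le> sqrt a\<close> by (simp add: abs_if)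
  have lip: "\<bar>arsinh x - arsinh y\<bar> \<le> \<bar>x - y\<bar>" for x y :: real
  proof -
    have "norm (arsinh x - arsinh y) \<le> 1 * norm (x - y)"
    proof (rule field_differentiable_bound[of UNIV])
      show "(arsinh has_field_derivative 1 / sqrt (z\<^sup>2 + 1)) (at z within UNIV)" for z :: real
        by (rule arsinh_real_has_field_derivative)
      have "1 \<le> sqrt (z\<^sup>2 + 1)" for z :: real
        by simp
      then show "norm (1 / sqrt (z\<^sup>2 + 1)) \<le> 1" for z :: real
        by (simp add: divide_le_eq add_nonneg_pos)
    qed auto
    then show ?thesis by simp
  qed
  have "\<bar>(transport b a v - v) $ 1\<bar> \<le> (sqrt a - 1) * \<bar>v $ 1\<bar>"
  proof -
    have "(transport b a v - v) $ 1 = (sqrt ((1 + s\<^sup>2) / (1 + \<sigma> * s\<^sup>2)) - 1) * v $ 1"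
      by (simp add: transport_def algebra_simps flip: \<sigma>_def s_def)
    then show ?thesis using r1 by (simp only: abs_mult mult_right_mono abs_ge_zero)
  qed
  moreover have "\<bar>(transport b a v - v) $ 2\<bar> \<le> (sqrt a - 1) * \<bar>v $ 2\<bar>"
  proof -
    have "(transport b a v - v) $ 2 = (1 / sqrt \<sigma> - 1) * v $ 2"
      by (simp add: transport_def left_diff_distrib flip: \<sigma>_def s_def)
    then show ?thesis using r2 by (simp only: abs_mult mult_right_mono abs_ge_zero)
  qed
  moreover have "\<bar>(transport b a v - v) $ 3\<bar> \<le> (sqrt a - 1) * \<bar>s\<bar>"
  proof -
    have "(transport b a v - v) $ 3 = arsinh (sqrt \<sigma> * s) - arsinh s"
      by (simp add: transport_def s_def arsinh_sinh_real flip: \<sigma>_def)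
    also have "\<bar>\<dots>\<bar> \<le> \<bar>sqrt \<sigma> * s - s\<bar>" by (rule lip)
    also have "sqrt \<sigma> * s - s = (sqrt \<sigma> - 1) * s" by (simp add: left_diff_distrib)
    also have "\<bar>\<dots>\<bar> \<le> (sqrt a - 1) * \<bar>s\<bar>"
      using r3 by (simp only: abs_mult mult_right_mono abs_ge_zero)
    finally show ?thesis .
  qed
  ultimately show ?thesis
    using norm_le_l1_cart[of "transport b a v - v"]
    by (simp add: dist_norm sum_3 distrib_left flip: s_def)
qed

end

text \<open>
  The chart is proper.  The second component bounds $p^2$, so the first one bounds $q^2 - b\sinh^2\tau$; as
  the third one bounds $q^2\sinh^2\tau$, this bounds $\sinh^2\tau$ and then $q^2$.
\<close>

lemma bounded_X_model_preimage:
  assumes b: "b > 0" and U: "bounded U"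
  obtains B where "\<And>v. X_model b 1 v \<in> U \<Longrightarrow> \<bar>v $ 1\<bar> + \<bar>v $ 2\<bar> + \<bar>sinh (v $ 3)\<bar> \<le> B"
proof -
  from U obtain R where R: "\<And>x. x \<in> U \<Longrightarrow> norm x \<le> R"
    unfolding bounded_iff by blast
  have le1: "\<bar>x\<bar> \<le> x\<^sup>2 + 1" for x :: real
    using sum_squares_ge_zero[of "\<bar>x\<bar> - 1" 0] zero_le_power2[of x]
    by (simp add: power2_eq_square algebra_simps abs_if split: if_splits)
  define P where "P = R\<^sup>2 / b"
  define S where "S = 1 + (2 * R + P + P) / b"
  define Q where "Q = 2 * R + b * S"
  have "\<bar>v $ 1\<bar> + \<bar>v $ 2\<bar> + \<bar>sinh (v $ 3)\<bar> \<le> (P + 1) + (Q + 1) + (S + 1)" if v: "X_model b 1 v \<in> U" for v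
  proof -
    define p q s where "p = v $ 1" "q = v $ 2" "s = sinh (v $ 3)"
    have comp: "\<bar>X_model b 1 v $ i\<bar> \<le> R" for i
      using component_le_norm_cart[of "X_model b 1 v" i] R[OF v] by linarith
    have R0: "R \<ge> 0" using comp[of 1] by linarith
    have 1: "p\<^sup>2 + q\<^sup>2 - b * s\<^sup>2 \<le> 2 * R" "- (2 * R) \<le> p\<^sup>2 + q\<^sup>2 - b * s\<^sup>2"
      using comp[of 1] unfolding X_model_def vector_3 p_q_s_def abs_le_iff by (simp_all add: field_simps)
    have "(cosh (v $ 3))\<^sup>2 * p\<^sup>2 * b \<le> R\<^sup>2"
      using power_mono[OF comp[of 2], of 2] b
      by (simp add: X_model_def p_q_s_def power_mult_distrib mult_ac)
    then have "(1 + s\<^sup>2) * p\<^sup>2 \<le> P"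
      using b by (simp add: P_def cosh_square_eq p_q_s_def field_simps)
    moreover have "0 \<le> s\<^sup>2 * p\<^sup>2" by simp
    ultimately have 2: "p\<^sup>2 \<le> P"
      unfolding distrib_right by linarith
    have "s\<^sup>2 * q\<^sup>2 * b \<le> R\<^sup>2"
      using power_mono[OF comp[of 3], of 2] b
      by (simp add: X_model_def p_q_s_def power_mult_distrib mult_ac)
    then have 3: "s\<^sup>2 * q\<^sup>2 \<le> P"
      using b by (simp add: P_def field_simps)
    have P0: "P \<ge> 0" using b by (simp add: P_def)
    have 4: "s\<^sup>2 \<le> S"
    proof (cases "s\<^sup>2 \<le> 1")
      case True
      have "S \<ge> 1" using R0 P0 b by (simp add: S_def)
      with True show ?thesis by simp
    next
      case False
      then have "P \<le> s\<^sup>2 * P" using P0 by (simp add: mult_le_cancel_right1)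
      have "s\<^sup>2 * (b * s\<^sup>2) \<le> s\<^sup>2 * (2 * R + P + q\<^sup>2)"
        using 1 2 by (intro mult_left_mono) auto
      also have "\<dots> \<le> s\<^sup>2 * (2 * R + P + P)"
        unfolding distrib_left using 3 \<open>P \<le> s\<^sup>2 * P\<close> by linarith
      finally have "b * s\<^sup>2 \<le> 2 * R + P + P"
        using False by (subst (asm) mult_le_cancel_left_pos) auto
      then show ?thesis
        using b by (simp add: S_def field_simps)
    qed
    have "b * s\<^sup>2 \<le> b * S" using 4 b by simp
    then have 5: "q\<^sup>2 \<le> Q"
      using 1 zero_le_power2[of p] unfolding Q_def by linarith
    show ?thesis
      using le1[of p] le1[of q] le1[of s] 2 4 5 unfolding p_q_s_def by linarith
  qed
  then show thesis by (rule that)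
qed

section \<open>Convergence on the covering space and on sheets\<close>

lemma elementary_X_model: "elementary W (\<lambda>a v. X_model b a v $ k)"
proof -
  have "\<forall>k. elementary W (\<lambda>a v. X_model b a v $ k)"
    unfolding forall_3 X_model_def vector_3 divide_inverse
    by (intro conjI elementary_intros)
  then show ?thesis by blast
qed

lemma smooth_on_X_model: "open W \<Longrightarrow> a > 0 \<Longrightarrow> smooth_on W (X_model b a)"
  by (rule smooth_on_vec, assumption,
      rule smooth_on_pullback[OF elementary_X_model elementary_mat_1 solves_id])

lemma smooth_on_solution:
  assumes "b > 0" "solves off_axis (inv_jac b) a U s"
  shows "smooth_on U s"
proof (rule smooth_on_vec)
  show "open U" using assms by (simp add: solves_def)
  show "smooth_on U (\<lambda>x. s x $ k)" for k
    by (rule smooth_on_pullback[OF elementary.coord elementary_inv_jac[OF assms(1)] assms(2)])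
qed

lemma X_model_axis: "b > 0 \<Longrightarrow> v \<notin> off_axis \<Longrightarrow> X_model b a v \<in> Gamma_curve b"
  by (simp add: off_axis_def X_model_def Gamma_curve_def power_mult_distrib)

text \<open>
  Off the branch curve, the inverse of any sheet falls under the general convergence result.
\<close>

lemma sheet_inv_solves:
  assumes b: "b > 0" and c: "cos \<epsilon> \<noteq> 0" and U: "U \<inter> Gamma_curve b = {}" and S: "is_sheet b \<epsilon> U S"
  shows "solves off_axis (inv_jac b) (1 / (cos \<epsilon>)\<^sup>2) U (sheet_inv b \<epsilon> S)"
proof (rule solves_inverse[OF b])
  have bij: "bij_betw (X_map b \<epsilon>) S U" and "open U" and sm: "smooth_on U (sheet_inv b \<epsilon> S)"
    using S by (auto simp: is_sheet_def diffeo_onto_def sheet_inv_def)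
  then show "open U" by blast
  have X: "X_map b \<epsilon> (sheet_inv b \<epsilon> S x) = x" if "x \<in> U" for x
    unfolding sheet_inv_def using bij that by (intro f_the_inv_into_f_bij_betw) auto
  then show "X_model b (1 / (cos \<epsilon>)\<^sup>2) (sheet_inv b \<epsilon> S x) = x" if "x \<in> U" for x
    using that by (simp only: X_map_eq)
  then show "sheet_inv b \<epsilon> S ` U \<subseteq> off_axis"
    using X_model_axis[OF b] U by (metis IntI empty_iff image_subsetI)
  have "sheet_inv b \<epsilon> S differentiable (at x)" if "x \<in> U" for x
    using sm that unfolding smooth_on_def by (metis iter_partial.simps(1))
  then show "continuous_on U (sheet_inv b \<epsilon> S)"
    by (auto intro!: continuous_at_imp_continuous_on differentiable_imp_continuous_within)
  show "1 / (cos \<epsilon>)\<^sup>2 > 0" using c by simp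
qed

text \<open>
  The transport carries a sheet of $X_0$ over \<open>U\<close> to one of $X_\varepsilon$.  It is only known to be continuous, but
  this suffices: the transported inverse is injective, so invariance of domain makes the new sheet open,
  and smoothness follows from the differential equation for inverses.
\<close>

lemma transported_sheet:
  assumes b: "b > 0" and c: "cos \<epsilon> \<noteq> 0" and U: "U \<inter> Gamma_curve b = {}" and S: "is_sheet b 0 U S"
  defines "a \<equiv> 1 / (cos \<epsilon>)\<^sup>2"
  shows "is_sheet b \<epsilon> U (transport b a ` S)"
    and "x \<in> U \<Longrightarrow> sheet_inv b \<epsilon> (transport b a ` S) x = transport b a (sheet_inv b 0 S x)"
proof -
  let ?T = "transport b a ` S" and ?s = "sheet_inv b 0 S"
  have a: "a \<ge> 1"
    using c by (simp add: a_def abs_square_le_1)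
  have bij: "bij_betw (X_map b 0) S U" and U_open: "open U"
    using S by (auto simp: is_sheet_def diffeo_onto_def)
  have s: "solves off_axis (inv_jac b) 1 U ?s"
    using sheet_inv_solves[OF b _ U S] by simp
  have s_S: "?s ` U = S"
    unfolding sheet_inv_def using bij by (metis bij_betw_def the_inv_into_onto)
  have X: "X_map b \<epsilon> (transport b a v) = X_map b 0 v" for v
    by (simp add: X_map_eq X_model_transport[OF b a] flip: a_def)
  have bij_T: "bij_betw (X_map b \<epsilon>) ?T U"
    using bij X by (auto simp: bij_betw_def inj_on_def image_image)
  have inv: "sheet_inv b \<epsilon> ?T x = transport b a (?s x)" if "x \<in> U" for x
  proof -
    have "X_map b \<epsilon> (transport b a (?s x)) = x"
      unfolding X sheet_inv_def using bij that by (intro f_the_inv_into_f_bij_betw) auto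
    moreover have "transport b a (?s x) \<in> ?T"
      using s_S that by blast
    ultimately show ?thesis
      unfolding sheet_inv_def using bij_T by (metis bij_betw_def the_inv_into_f_f)
  qed
  then show "x \<in> U \<Longrightarrow> sheet_inv b \<epsilon> ?T x = transport b a (?s x)" .
  have cont_s: "continuous_on U ?s"
    using s unfolding solves_def
    by (meson has_derivative_continuous continuous_at_imp_continuous_on)
  have "continuous_on U (\<lambda>x. transport b a (?s x))"
    using s by (intro continuous_on_compose2[OF continuous_on_transport[OF b a] cont_s])
      (auto simp: solves_def)
  then have cont: "continuous_on U (sheet_inv b \<epsilon> ?T)"
    using inv by (simp cong: continuous_on_cong)
  have img: "sheet_inv b \<epsilon> ?T ` U = ?T"
    unfolding sheet_inv_def using bij_T by (metis bij_betw_def the_inv_into_onto)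
  have X_inv: "X_map b \<epsilon> (sheet_inv b \<epsilon> ?T x) = x" if "x \<in> U" for x
    unfolding sheet_inv_def using bij_T that by (intro f_the_inv_into_f_bij_betw) auto
  have "inj_on (sheet_inv b \<epsilon> ?T) U"
    using X_inv by (metis inj_onI)
  from invariance_of_domain[OF cont U_open this] have T_open: "open ?T"
    by (simp add: img)
  have "solves off_axis (inv_jac b) a U (sheet_inv b \<epsilon> ?T)"
  proof (rule solves_inverse[OF b _ U_open _ cont])
    show "a > 0" using a by simp
    show "sheet_inv b \<epsilon> ?T ` U \<subseteq> off_axis"
      using s inv transport_off_axis[OF b a] by (auto simp: solves_def)
    show "X_model b a (sheet_inv b \<epsilon> ?T x) = x" if "x \<in> U" for x
      using X_inv[OF that] by (simp only: X_map_eq a_def)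
  qed
  then have "smooth_on U (sheet_inv b \<epsilon> ?T)"
    by (rule smooth_on_solution[OF b])
  moreover have "smooth_on ?T (X_map b \<epsilon>)"
    unfolding X_map_eq a_def[symmetric] using a by (intro smooth_on_X_model T_open) auto
  ultimately show "is_sheet b \<epsilon> U ?T"
    using T_open U_open bij_T by (simp add: is_sheet_def diffeo_onto_def sheet_inv_def)
qed

lemma eventually_sin_cos_nonzero: "\<forall>\<^sub>F \<epsilon>::real in at 0. sin \<epsilon> \<noteq> 0 \<and> cos \<epsilon> \<noteq> 0"
  unfolding eventually_at
proof (intro exI[of _ 1] conjI ballI impI)
  fix \<epsilon> :: real assume \<epsilon>: "\<epsilon> \<noteq> 0 \<and> dist \<epsilon> 0 < 1"
  then have "\<bar>\<epsilon>\<bar> < 1" by simp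
  then have "- pi < \<epsilon>" "\<epsilon> < pi"
    using pi_gt3 by linarith+
  with \<epsilon> show "sin \<epsilon> \<noteq> 0"
    using sin_eq_0_pi[of \<epsilon>] by auto
  have "cos \<epsilon> > 0"
    using \<open>\<bar>\<epsilon>\<bar> < 1\<close> pi_gt3 by (intro cos_gt_zero_pi) auto
  then show "cos \<epsilon> \<noteq> 0" by simp
qed simp

lemma scale_tendsto: "((\<lambda>\<epsilon>::real. 1 / (cos \<epsilon>)\<^sup>2) \<longlongrightarrow> 1) (at 0)"
proof -
  have "((\<lambda>\<epsilon>::real. 1 / (cos \<epsilon>)\<^sup>2) \<longlongrightarrow> 1 / (cos 0)\<^sup>2) (at 0)"
    by (intro tendsto_intros) auto
  then show ?thesis by simp
qed

text \<open>
  Over a bounded \<open>U\<close> the sheet stays in a bounded region by properness, so the displacement bound for the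
  transport is uniform on it.
\<close>

lemma nearby_sheets_exist:
  assumes b: "b > 0" and U: "bounded U" "U \<inter> Gamma_curve b = {}" and S: "is_sheet b 0 U S"
  shows "nearby_sheets b U S (\<lambda>\<epsilon>. transport b (1 / (cos \<epsilon>)\<^sup>2) ` S)"
  unfolding nearby_sheets_def
proof
  let ?a = "\<lambda>\<epsilon>::real. 1 / (cos \<epsilon>)\<^sup>2"
  show "\<forall>\<^sub>F \<epsilon> in at 0. is_sheet b \<epsilon> U (transport b (?a \<epsilon>) ` S)"
    using eventually_sin_cos_nonzero
    by eventually_elim (use transported_sheet(1)[OF b _ U(2) S] in blast)
  obtain B where B: "\<And>v. X_model b 1 v \<in> U \<Longrightarrow> \<bar>v $ 1\<bar> + \<bar>v $ 2\<bar> + \<bar>sinh (v $ 3)\<bar> \<le> B"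
    using bounded_X_model_preimage[OF b U(1)] by blast
  have X: "X_model b 1 (sheet_inv b 0 S x) = x" if "x \<in> U" for x
    using S that unfolding is_sheet_def diffeo_onto_def sheet_inv_def
    by (metis X_map_eq cos_zero power_one div_by_1 f_the_inv_into_f_bij_betw)
  have "((\<lambda>\<epsilon>. (sqrt (?a \<epsilon>) - 1) * B) \<longlongrightarrow> (sqrt 1 - 1) * B) (at 0)"
    by (intro tendsto_intros scale_tendsto)
  then have lim: "((\<lambda>\<epsilon>. (sqrt (?a \<epsilon>) - 1) * B) \<longlongrightarrow> 0) (at 0)"
    by simp
  show "uniform_limit U (\<lambda>\<epsilon>. sheet_inv b \<epsilon> (transport b (?a \<epsilon>) ` S)) (sheet_inv b 0 S) (at 0)"
  proof (rule uniform_limitI)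
    fix e :: real assume "e > 0"
    with lim have "\<forall>\<^sub>F \<epsilon> in at 0. (sqrt (?a \<epsilon>) - 1) * B < e"
      by (rule order_tendstoD)
    then show "\<forall>\<^sub>F \<epsilon> in at 0. \<forall>x\<in>U. dist (sheet_inv b \<epsilon> (transport b (?a \<epsilon>) ` S) x) (sheet_inv b 0 S x) < e"
      using eventually_sin_cos_nonzero
    proof eventually_elim
      case (elim \<epsilon>)
      have a: "?a \<epsilon> \<ge> 1"
        using elim by (simp add: abs_square_le_1)
      show ?case
      proof
        fix x assume x: "x \<in> U"
        let ?v = "sheet_inv b 0 S x"
        have "dist (sheet_inv b \<epsilon> (transport b (?a \<epsilon>) ` S) x) ?v = dist (transport b (?a \<epsilon>) ?v) ?v"
          using transported_sheet(2)[OF b _ U(2) S x] elim by simp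
        also have "\<dots> \<le> (sqrt (?a \<epsilon>) - 1) * (\<bar>?v $ 1\<bar> + \<bar>?v $ 2\<bar> + \<bar>sinh (?v $ 3)\<bar>)"
          by (rule transport_dist[OF b a])
        also have "\<dots> \<le> (sqrt (?a \<epsilon>) - 1) * B"
          using a x by (intro mult_left_mono B) (auto simp: X)
        also have "\<dots> < e" using elim by simp
        finally show "dist (sheet_inv b \<epsilon> (transport b (?a \<epsilon>) ` S) x) ?v < e" .
      qed
    qed
  qed
qed

lemma graph_potential_limit_on_cover:
  assumes b: "b > 0"
  shows "smooth_loc_limit UNIV (\<lambda>\<epsilon> v. - (cot \<epsilon> / b) * graph_potential b \<epsilon> v) (f_cover b) (at 0)"
proof -
  have chart: "\<forall>\<^sub>F \<epsilon>::real in at 0. solves UNIV (\<lambda>a v. mat 1) (1 / (cos \<epsilon>)\<^sup>2) UNIV (\<lambda>x. x)"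
    using eventually_sin_cos_nonzero by eventually_elim (simp add: solves_id)
  have chart0: "solves UNIV (\<lambda>a v. mat 1) 1 UNIV (\<lambda>x. x)"
    by (simp add: solves_id)
  have G: "\<forall>\<^sub>F \<epsilon> in at 0. (\<lambda>v. - (cot \<epsilon> / b) * graph_potential b \<epsilon> v) =
      (\<lambda>x. rescaled_potential b (1 / (cos \<epsilon>)\<^sup>2) x)"
    using eventually_sin_cos_nonzero
    by eventually_elim (intro ext rescaled_graph_potential[OF b]; simp)
  have f: "f_cover b = (\<lambda>x. rescaled_potential b 1 x)"
    by (simp add: f_cover_eq[OF b])
  show ?thesis
    by (rule smooth_loc_limit_pullback[OF elementary_potential elementary_mat_1 open_UNIV
      chart chart0 scale_tendsto uniform_limit_const G f])
qed

lemma graph_potential_limit_on_sheet: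
  assumes b: "b > 0" and U: "U \<inter> Gamma_curve b = {}" and S: "is_sheet b 0 U S"
    and T: "nearby_sheets b U S T"
  shows "smooth_loc_limit U (\<lambda>\<epsilon> x. - (cot \<epsilon> / b) * graph_potential b \<epsilon> (sheet_inv b \<epsilon> (T \<epsilon>) x))
    (\<lambda>x. f_cover b (sheet_inv b 0 S x)) (at 0)"
proof -
  have "\<forall>\<^sub>F \<epsilon> in at 0. is_sheet b \<epsilon> U (T \<epsilon>)"
    using T by (simp add: nearby_sheets_def)
  then have chart:
    "\<forall>\<^sub>F \<epsilon> in at 0. solves off_axis (inv_jac b) (1 / (cos \<epsilon>)\<^sup>2) U (sheet_inv b \<epsilon> (T \<epsilon>))"
    using eventually_sin_cos_nonzero
    by eventually_elim (use sheet_inv_solves[OF b _ U] in blast)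
  have chart0: "solves off_axis (inv_jac b) 1 U (sheet_inv b 0 S)"
    using sheet_inv_solves[OF b _ U S] by simp
  have lim: "uniform_limit U (\<lambda>\<epsilon>. sheet_inv b \<epsilon> (T \<epsilon>)) (sheet_inv b 0 S) (at 0)"
    using T by (simp add: nearby_sheets_def)
  have G: "\<forall>\<^sub>F \<epsilon> in at 0. (\<lambda>x. - (cot \<epsilon> / b) * graph_potential b \<epsilon> (sheet_inv b \<epsilon> (T \<epsilon>) x)) =
      (\<lambda>x. rescaled_potential b (1 / (cos \<epsilon>)\<^sup>2) (sheet_inv b \<epsilon> (T \<epsilon>) x))"
    using eventually_sin_cos_nonzero
    by eventually_elim (intro ext rescaled_graph_potential[OF b]; simp)
  have f: "(\<lambda>x. f_cover b (sheet_inv b 0 S x)) = (\<lambda>x. rescaled_potential b 1 (sheet_inv b 0 S x))"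
    by (simp add: f_cover_eq[OF b])
  show ?thesis
    by (rule smooth_loc_limit_pullback[OF elementary_potential elementary_inv_jac[OF b]
      open_off_axis chart chart0 scale_tendsto lim G f])
qed

theorem proposition1p11:
  fixes b :: real
  assumes "b > 0"
  shows "smooth_loc_limit UNIV (\<lambda>\<epsilon> v. - (cot \<epsilon> / b) * graph_potential b \<epsilon> v) (f_cover b) (at 0) \<and>
    (\<forall>U S. open U \<and> simply_connected U \<and> compact (closure U) \<and> closure U \<inter> Gamma_curve b = {} \<and>
        is_sheet b 0 U S \<longrightarrow>
      (\<exists>T. nearby_sheets b U S T) \<and>
      (\<forall>T. nearby_sheets b U S T \<longrightarrow>
        smooth_loc_limit U
          (\<lambda>\<epsilon> x. - (cot \<epsilon> / b) * graph_potential b \<epsilon> (sheet_inv b \<epsilon> (T \<epsilon>) x))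
          (\<lambda>x. f_cover b (sheet_inv b 0 S x)) (at 0)))"
proof (intro conjI allI impI; (elim conjE)?)
  show "smooth_loc_limit UNIV (\<lambda>\<epsilon> v. - (cot \<epsilon> / b) * graph_potential b \<epsilon> v) (f_cover b) (at 0)"
    using graph_potential_limit_on_cover[OF assms] .
  fix U S
  assume "compact (closure U)" "closure U \<inter> Gamma_curve b = {}" and S: "is_sheet b 0 U S"
  then have "bounded U" and U: "U \<inter> Gamma_curve b = {}"
    using bounded_subset[OF compact_imp_bounded closure_subset] closure_subset[of U] by blast+
  then show "\<exists>T. nearby_sheets b U S T"
    using nearby_sheets_exist[OF assms _ _ S] by blast
  show "smooth_loc_limit U (\<lambda>\<epsilon> x. - (cot \<epsilon> / b) * graph_potential b \<epsilon> (sheet_inv b \<epsilon> (T \<epsilon>) x))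
      (\<lambda>x. f_cover b (sheet_inv b 0 S x)) (at 0)" if "nearby_sheets b U S T" for T
    using graph_potential_limit_on_sheet[OF assms U S that] .
qed

end
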